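(* Let $n\ge 1$ be an integer and let $X$ be a Lévy process such that $\int_{\mathbb{R}\setminus\{0\}}(x^2\wedge|x|)K_0(dx)<\infty$ and such that there exists $\delta>0$ with $\int_{x<-1}e^{-(n+\delta)x}K_0(dx)<\infty$. Suppose that $\Phi$ is injective on $\{0,1,\dots,n\}$. Then for every $t>0$ $${\bf E}(I_t^n)=n!\sum_{k=0}^{n-1}\frac{e^{-\Phi(k)t}-e^{-\Phi(n)t}}{\displaystyle\prod_{0\le i\le n,\ i\ne k}(\Phi(i)-\Phi(k))} .$$
   Context: $X=(X_t)_{t\ge 0}$ is a real-valued Lévy process, $X_0=0$, with parameters $(b_0,c_0,K_0)$ (drift written without truncation of jumps, Gaussian variance $c_0$, Lévy measure $K_0$). Its Laplace exponent is given by ${\bf E}(e^{-\alpha X_t})=e^{-t\Phi(\alpha)}$, $$\Phi(\alpha)=\alpha b_0-\tfrac12\alpha^2c_0-\int_{\mathbb{R}\setminus\{0\}}(e^{-\alpha x}-1+\alpha x)K_0(dx).$$ $I_t=\int_0^te^{-X_s}ds$. *)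

theory Defs
  imports "HOL-Probability.Probability"
begin

(* The time set is [0,\<infinity>); values of X at negative times are irrelevant.  The cadlag
   property is required of every path, so that pathwise time integrals are random
   variables even when M is not complete. *)
locale levy_process = prob_space M for M :: "'a measure" +
  fixes X :: "real \<Rightarrow> 'a \<Rightarrow> real"
  assumes measurable_X: "\<And>t. 0 \<le> t \<Longrightarrow> X t \<in> borel_measurable M"
    and starts_at_0: "AE \<omega> in M. X 0 \<omega> = 0"
    and indep_increments:
      "\<And>\<tau> m. 0 \<le> \<tau> 0 \<Longrightarrow> mono \<tau> \<Longrightarrow>
         indep_vars (\<lambda>_. borel) (\<lambda>i \<omega>. X (\<tau> (Suc i)) \<omega> - X (\<tau> i) \<omega>) {..<m::nat}"
    and stationary_increments:
      "\<And>s t. 0 \<le> s \<Longrightarrow> s \<le> t \<Longrightarrow>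
         distr M borel (\<lambda>\<omega>. X t \<omega> - X s \<omega>) = distr M borel (X (t - s))"
    and right_continuous:
      "\<And>\<omega> t. \<omega> \<in> space M \<Longrightarrow> 0 \<le> t \<Longrightarrow> continuous (at_right t) (\<lambda>s. X s \<omega>)"
    and left_limits:
      "\<And>\<omega> t. \<omega> \<in> space M \<Longrightarrow> 0 < t \<Longrightarrow> \<exists>l. ((\<lambda>s. X s \<omega>) \<longlongrightarrow> l) (at_left t)"

(* A measure on the real line without atom at 0, in place of one on \<real> - {0}. *)
definition levy_measure :: "real measure \<Rightarrow> bool" where
  "levy_measure K \<longleftrightarrow> sets K = sets borel \<and> emeasure K {0} = 0 \<and>
     (\<integral>\<^sup>+x. ennreal (min 1 (x\<^sup>2)) \<partial>K) < \<infinity>"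

(* Levy-Khintchine formula without truncation of the jumps.  The integral converges
   absolutely only if min (x\<^sup>2) \<bar>x\<bar> is K-integrable, so the predicate is meant to be
   used together with that hypothesis. *)
definition has_levy_parameters ::
  "'a measure \<Rightarrow> (real \<Rightarrow> 'a \<Rightarrow> real) \<Rightarrow> real \<Rightarrow> real \<Rightarrow> real measure \<Rightarrow> bool" where
  "has_levy_parameters M X b c K \<longleftrightarrow> 0 \<le> c \<and> levy_measure K \<and>
     (\<forall>t\<ge>0. \<forall>u. char (distr M borel (X t)) u =
        exp (of_real t * (\<i> * of_real (u * b) - of_real (u\<^sup>2 * c / 2) +
          (\<integral>x. (exp (\<i> * of_real (u * x)) - 1 - \<i> * of_real (u * x)) \<partial>K))))"

definition laplace_exponent :: "real \<Rightarrow> real \<Rightarrow> real measure \<Rightarrow> real \<Rightarrow> real" where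
  "laplace_exponent b c K \<alpha> =
     \<alpha> * b - \<alpha>\<^sup>2 * c / 2 - (\<integral>x. (exp (- \<alpha> * x) - 1 + \<alpha> * x) \<partial>K)"

definition exp_functional :: "(real \<Rightarrow> 'a \<Rightarrow> real) \<Rightarrow> real \<Rightarrow> 'a \<Rightarrow> real" where
  "exp_functional X t \<omega> = (LINT s:{0..t}|lborel. exp (- X s \<omega>))"

end

theory Submission
  imports Defs "HOL-Complex_Analysis.Complex_Analysis"
begin

text \<open>
  The characteristic exponent extends holomorphically to the strip \<open>0 \<le> Im z \<le> a\<close>, for every \<open>a\<close>
  strictly below the order of the exponential moment of the jumps. Damping \<open>exp (- a X\<^sub>t)\<close> by a
  Gaussian, shifting the contour in the resulting Fourier integral and letting the damping vanish
  yields \<open>E exp (- a X\<^sub>t) = exp (- t \<Phi> a)\<close>, finiteness included.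

  By symmetry \<open>I\<^sub>t ^ n\<close> is \<open>n!\<close> times an integral over the simplex \<open>0 \<le> u\<^sub>1 \<le> \<dots> \<le> u\<^sub>n \<le> t\<close>. By Tonelli,
  independence and stationarity of the increments, its expectation is the \<open>n\<close>-fold convolution of
  exponentials \<open>v\<^sub>n' + \<Phi> n v\<^sub>n = v\<^sub>n\<^sub>-\<^sub>1\<close>, \<open>v\<^sub>n 0 = 0\<close>, which is solved by the divided difference
  \<open>\<Sum>k\<le>n. exp (- \<Phi> k t) / (\<Prod>i\<noteq>k. \<Phi> i - \<Phi> k)\<close>.
\<close>

section \<open>Exponential moments from the characteristic function\<close>

text \<open>The mean value inequality on the convex set \<open>S\<close> bounds the difference
  quotients by \<open>g\<close>, and dominated convergence along sequences does the rest.
  Derivatives are taken within \<open>S\<close> so that boundary points of a closed strip are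
  covered.\<close>

lemma has_field_derivative_integral:
  fixes f f' :: "complex \<Rightarrow> 'b \<Rightarrow> complex"
  assumes S: "convex S" "z \<in> S"
    and int: "\<And>w. w \<in> S \<Longrightarrow> integrable M (f w)"
    and meas: "f' z \<in> borel_measurable M"
    and der: "\<And>w x. w \<in> S \<Longrightarrow> x \<in> space M \<Longrightarrow>
      ((\<lambda>w. f w x) has_field_derivative f' w x) (at w within S)"
    and bound: "\<And>w x. w \<in> S \<Longrightarrow> x \<in> space M \<Longrightarrow> norm (f' w x) \<le> g x"
    and g: "integrable M g"
  shows "((\<lambda>w. \<integral>x. f w x \<partial>M) has_field_derivative (\<integral>x. f' z x \<partial>M)) (at z within S)"
  unfolding has_field_derivative_iff tendsto_at_iff_sequentially
proof (intro allI impI)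
  fix X assume X: "\<forall>i. X i \<in> S - {z}" "X \<longlonglongrightarrow> z"
  have "(\<lambda>i. \<integral>x. (f (X i) x - f z x) / (X i - z) \<partial>M) \<longlonglongrightarrow> (\<integral>x. f' z x \<partial>M)"
  proof (rule integral_dominated_convergence[where w=g])
    show "AE x in M. (\<lambda>i. (f (X i) x - f z x) / (X i - z)) \<longlonglongrightarrow> f' z x"
    proof (rule AE_I2)
      fix x assume "x \<in> space M"
      from der[OF S(2) this] X show "(\<lambda>i. (f (X i) x - f z x) / (X i - z)) \<longlonglongrightarrow> f' z x"
        unfolding has_field_derivative_iff tendsto_at_iff_sequentially comp_def by blast
    qed
    fix i
    have Xi: "X i \<in> S" "X i \<noteq> z" using X(1) by auto
    show "(\<lambda>x. (f (X i) x - f z x) / (X i - z)) \<in> borel_measurable M"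
      using int[OF Xi(1)] int[OF S(2)] by measurable
    show "AE x in M. norm ((f (X i) x - f z x) / (X i - z)) \<le> g x"
    proof (rule AE_I2)
      fix x assume x: "x \<in> space M"
      have "norm (f (X i) x - f z x) \<le> g x * norm (X i - z)"
        by (rule field_differentiable_bound[OF S(1) der bound]) (use x Xi S in auto)
      then show "norm ((f (X i) x - f z x) / (X i - z)) \<le> g x"
        using Xi(2) by (simp add: norm_divide divide_le_eq)
    qed
  qed (use meas g in auto)
  moreover have "(\<integral>x. (f (X i) x - f z x) / (X i - z) \<partial>M)
      = ((\<integral>x. f (X i) x \<partial>M) - (\<integral>x. f z x \<partial>M)) / (X i - z)" for i
    by (subst integral_divide_zero, subst Bochner_Integration.integral_diff)
       (use int[of "X i"] int[OF S(2)] X(1) in auto)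
  ultimately show "((\<lambda>y. ((\<integral>x. f y x \<partial>M) - (\<integral>x. f z x \<partial>M)) / (y - z)) \<circ> X)
      \<longlonglongrightarrow> (\<integral>x. f' z x \<partial>M)"
    by (simp only: comp_def)
qed

section \<open>The jump part of the exponent on a horizontal strip\<close>

text \<open>The lower edge carries the characteristic function, and the point
  \<open>\<i> * a\<close> on the upper edge yields the Laplace transform; hence the strip is
  closed.\<close>

definition upper_strip :: "real \<Rightarrow> complex set" where
  "upper_strip a = {z. 0 \<le> Im z \<and> Im z \<le> a}"

lemma convex_upper_strip: "convex (upper_strip a)"
proof -
  have "upper_strip a = {z. Im z \<ge> 0} \<inter> {z. Im z \<le> a}"
    by (auto simp: upper_strip_def)
  then show ?thesis
    by (simp add: convex_Int convex_halfspace_Im_ge convex_halfspace_Im_le)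
qed

text \<open>Dominates, up to a constant, the derivative in \<open>z\<close> of the kernel
  \<open>exp (\<i> z x) - 1 - \<i> z x\<close> on bounded parts of the strip \<open>0 \<le> Im z \<le> a\<close> for every \<open>a < A\<close>.\<close>

definition jump_weight :: "real \<Rightarrow> real \<Rightarrow> real" where
  "jump_weight A x = min (x\<^sup>2) \<bar>x\<bar> + indicator {..<-1} x * exp (- A * x)"

lemma jump_weight_nonneg: "0 \<le> jump_weight A x"
  by (simp add: jump_weight_def)

lemma norm_exp_minus_1_le:
  fixes w :: complex
  assumes "norm w \<le> R"
  shows "norm (exp w - 1) \<le> exp R * norm w"
proof -
  have "norm (exp w - exp 0) \<le> exp R * norm (w - 0)"
  proof (rule field_differentiable_bound[of "cball 0 R" exp exp])
    fix z :: complex assume "z \<in> cball 0 R"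
    then have "Re z \<le> R" using complex_Re_le_cmod[of z] by simp
    then show "norm (exp z) \<le> exp R" by simp
  qed (use assms norm_ge_zero[of w] in \<open>auto intro: DERIV_exp has_field_derivative_at_within simp del: norm_ge_zero\<close>)
  then show ?thesis by simp
qed

text \<open>Three ranges of \<open>x\<close> are treated separately. For
  \<open>\<bar>x\<bar> \<le> 1\<close> the factor \<open>exp (\<i> * z * x) - 1\<close> is of order
  \<open>x\<close>, which gives the square. For \<open>x > 1\<close> the exponential is bounded by 1
  because \<open>Im z \<ge> 0\<close>. For \<open>x < -1\<close> it is at most
  \<open>exp (- a * x)\<close>, and the gap \<open>A - a\<close> absorbs the remaining factor
  \<open>\<bar>x\<bar>\<close>.\<close>

lemma kernel_derivative_bound:
  assumes a: "a < A" and R: "0 \<le> R" and z: "z \<in> upper_strip a" "norm z \<le> R"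
  shows "norm (\<i> * of_real x * (exp (\<i> * z * of_real x) - 1))
    \<le> (R * exp R + 2 + 1 / (A - a)) * jump_weight A x"
proof -
  let ?w = "\<i> * z * of_real x"
  have Q: "min (x\<^sup>2) \<bar>x\<bar> \<le> jump_weight A x"
    by (simp add: jump_weight_def)
  have n: "norm (\<i> * of_real x * (exp ?w - 1)) = \<bar>x\<bar> * norm (exp ?w - 1)"
    by (simp add: norm_mult)
  have nw: "norm ?w \<le> R * \<bar>x\<bar>"
    using z by (simp add: norm_mult mult_right_mono)
  have ne: "norm (exp ?w) = exp (- Im z * x)" by simp
  have C: "0 \<le> R * exp R" "0 \<le> 1 / (A - a)" using a R by auto
  consider "\<bar>x\<bar> \<le> 1" | "x > 1" | "x < -1" by linarith
  then show ?thesis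
  proof cases
    case 1
    have "norm ?w \<le> R" using nw 1 R by (meson mult_left_le order_trans)
    then have "norm (exp ?w - 1) \<le> exp R * (R * \<bar>x\<bar>)"
      using norm_exp_minus_1_le[of ?w R] nw by (meson exp_ge_zero mult_left_mono order_trans)
    then have "\<bar>x\<bar> * norm (exp ?w - 1) \<le> \<bar>x\<bar> * (exp R * (R * \<bar>x\<bar>))"
      by (rule mult_left_mono) simp
    also have "\<dots> = R * exp R * x\<^sup>2" by (simp add: power2_eq_square abs_mult_self_eq)
    also have "x\<^sup>2 = min (x\<^sup>2) \<bar>x\<bar>"
      using 1 by (simp add: min_def power2_eq_square abs_square_le_1)
        (metis abs_ge_zero abs_mult_self_eq mult_left_le)
    also have "R * exp R * min (x\<^sup>2) \<bar>x\<bar> \<le> R * exp R * jump_weight A x"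
      by (rule mult_left_mono[OF Q C(1)])
    also have "\<dots> \<le> (R * exp R + 2 + 1 / (A - a)) * jump_weight A x"
      using C jump_weight_nonneg by (intro mult_right_mono) auto
    finally show ?thesis using n by simp
  next
    case 2
    have "norm (exp ?w - 1) \<le> exp (- Im z * x) + 1"
      using norm_triangle_ineq4[of "exp ?w" 1] ne by simp
    also have "\<dots> \<le> 2" using 2 z by (simp add: upper_strip_def)
    finally have "\<bar>x\<bar> * norm (exp ?w - 1) \<le> \<bar>x\<bar> * 2"
      by (rule mult_left_mono) simp
    also have "\<bar>x\<bar> * 2 \<le> jump_weight A x * 2"
      using Q 2 by (simp add: min_def power2_eq_square)
    also have "\<dots> \<le> jump_weight A x * (R * exp R + 2 + 1 / (A - a))"
      using C jump_weight_nonneg by (intro mult_left_mono) auto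
    finally show ?thesis using n by (simp add: mult.commute)
  next
    case 3
    have "norm (exp ?w - 1) \<le> exp (- Im z * x) + 1"
      using norm_triangle_ineq4[of "exp ?w" 1] ne by simp
    also have "\<dots> \<le> exp (- a * x) + 1"
      using 3 z by (simp add: upper_strip_def mult_right_mono_neg)
    finally have 1: "\<bar>x\<bar> * norm (exp ?w - 1) \<le> \<bar>x\<bar> * (exp (- a * x) + 1)"
      by (rule mult_left_mono) simp
    \<comment> \<open>\<open>y \<le> exp y\<close> trades the factor \<open>\<bar>x\<bar>\<close>
      for the spare rate \<open>A - a\<close>, at the price of the constant
      \<open>1 / (A - a)\<close>.\<close>
    have "(A - a) * \<bar>x\<bar> \<le> exp ((A - a) * \<bar>x\<bar>)"
      using exp_ge_add_one_self[of "(A - a) * \<bar>x\<bar>"] by linarith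
    then have "\<bar>x\<bar> \<le> 1 / (A - a) * exp ((A - a) * \<bar>x\<bar>)"
      using a by (simp add: field_simps)
    then have "\<bar>x\<bar> * exp (- a * x) \<le> 1 / (A - a) * exp ((A - a) * \<bar>x\<bar>) * exp (- a * x)"
      by (rule mult_right_mono) simp
    also have "\<dots> = 1 / (A - a) * exp (- A * x)"
      using 3 by (simp add: exp_add[symmetric] algebra_simps)
    also have "\<dots> \<le> 1 / (A - a) * jump_weight A x"
      using 3 C by (intro mult_left_mono) (auto simp: jump_weight_def)
    finally have 2: "\<bar>x\<bar> * exp (- a * x) \<le> 1 / (A - a) * jump_weight A x" .
    have "\<bar>x\<bar> * 1 \<le> \<bar>x\<bar> * \<bar>x\<bar>" using 3 by (intro mult_left_mono) auto
    then have "min (x\<^sup>2) \<bar>x\<bar> = \<bar>x\<bar>" by (simp add: power2_eq_square min_absorb2)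
    then have 3: "\<bar>x\<bar> \<le> jump_weight A x" using Q by simp
    have "\<bar>x\<bar> * norm (exp ?w - 1) \<le> (1 / (A - a) + 1) * jump_weight A x"
      using 1 2 3 unfolding distrib_left distrib_right mult_1_right mult_1_left by linarith
    also have "\<dots> \<le> (R * exp R + 2 + 1 / (A - a)) * jump_weight A x"
      using C jump_weight_nonneg by (intro mult_right_mono) auto
    finally show ?thesis using n by simp
  qed
qed

text \<open>At real \<open>z\<close> this is the integral in \<open>has_levy_parameters\<close>, at
  \<open>z = \<i> * a\<close> the one in \<open>laplace_exponent\<close>.\<close>

definition jump_exponent :: "real measure \<Rightarrow> complex \<Rightarrow> complex" where
  "jump_exponent K z = (\<integral>x. exp (\<i> * z * of_real x) - 1 - \<i> * z * of_real x \<partial>K)"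

text \<open>The kernel vanishes at \<open>z = 0\<close> and its derivative is dominated by a
  multiple of \<open>jump_weight A\<close>. The mean value inequality between 0 and \<open>w\<close>
  gives integrability, and differentiation under the integral sign gives the derivative.\<close>

lemma
  assumes K: "sets K = sets borel" and w: "integrable K (jump_weight A)"
    and a: "0 \<le> a" "a < A" and z: "z \<in> upper_strip a"
  shows integrable_jump_kernel:
      "integrable K (\<lambda>x. exp (\<i> * z * of_real x) - 1 - \<i> * z * of_real x)" (is ?int)
    and jump_exponent_derivative:
      "\<exists>D. (jump_exponent K has_field_derivative D) (at z within upper_strip a)" (is ?der)
proof -
  note [measurable_cong] = K
  \<comment> \<open>The dominating constant depends on a bound for the modulus of \<open>z\<close>,
    hence the ball. Its radius exceeds \<open>norm z\<close>, so derivatives at \<open>z\<close>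
    within \<open>S\<close> and within the strip agree.\<close>
  define R where "R = norm z + 1"
  define S where "S = upper_strip a \<inter> ball 0 R"
  define C where "C = R * exp R + 2 + 1 / (A - a)"
  define f where "f w x = exp (\<i> * w * of_real x) - 1 - \<i> * w * of_real x" for w :: complex and x :: real
  define f' where "f' w x = \<i> * of_real x * (exp (\<i> * w * of_real x) - 1)" for w :: complex and x :: real
  have "convex S"
    unfolding S_def by (intro convex_Int convex_upper_strip convex_ball)
  moreover have "z \<in> S" "0 \<in> S"
    using z a by (auto simp: S_def R_def upper_strip_def add_nonneg_pos)
  ultimately have S: "convex S" "z \<in> S" "0 \<in> S" by auto
  have R: "0 \<le> R" by (simp add: R_def)
  have der: "((\<lambda>w. f w x) has_field_derivative f' w x) (at w within S)" for w x
    unfolding f_def f'_def by (auto intro!: derivative_eq_intros simp: algebra_simps)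
  have bound: "norm (f' w x) \<le> C * jump_weight A x" if "w \<in> S" for w x
    unfolding f'_def C_def using that
    by (intro kernel_derivative_bound[OF a(2) R]) (auto simp: S_def)
  have g: "integrable K (\<lambda>x. C * jump_weight A x)" using w by simp
  have int: "integrable K (f w)" if "w \<in> S" for w
  proof (rule Bochner_Integration.integrable_bound)
    show "integrable K (\<lambda>x. C * jump_weight A x * norm w)" using g by simp
    show "f w \<in> borel_measurable K" unfolding f_def by measurable
    show "AE x in K. norm (f w x) \<le> norm (C * jump_weight A x * norm w)"
    proof (rule AE_I2)
      fix x
      have "norm (f w x - f 0 x) \<le> (C * jump_weight A x) * norm (w - 0)"
        by (rule field_differentiable_bound[OF S(1) der bound]) (use that S in auto)
      then show "norm (f w x) \<le> norm (C * jump_weight A x * norm w)"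
        by (simp add: f_def)
    qed
  qed
  show ?int using int[OF S(2)] by (simp add: f_def[abs_def])
  have "((\<lambda>w. \<integral>x. f w x \<partial>K) has_field_derivative (\<integral>x. f' z x \<partial>K)) (at z within S)"
    by (rule has_field_derivative_integral[OF S(1,2) int _ der bound g])
       (auto simp: f'_def)
  moreover have "at z within S = at z within upper_strip a"
    by (rule at_within_nhd[of _ "ball 0 R"]) (auto simp: S_def R_def intro!: add_nonneg_pos)
  ultimately show ?der
    by (auto simp: jump_exponent_def[abs_def] f_def)
qed

text \<open>The real part of \<open>exp (\<i> * z * x)\<close> is at most its modulus
  \<open>exp (- Im z * x)\<close>, and the real part of the compensating terms depends only on
  \<open>Im z\<close>. Bounds on the strip thus reduce to the imaginary axis.\<close>

lemma Re_jump_exponent_le: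
  assumes K: "sets K = sets borel" and w: "integrable K (jump_weight A)"
    and z: "0 \<le> Im z" "Im z < A"
  shows "Re (jump_exponent K z) \<le> Re (jump_exponent K (\<i> * of_real (Im z)))"
proof -
  have i1: "integrable K (\<lambda>x. exp (\<i> * z * of_real x) - 1 - \<i> * z * of_real x)"
    by (rule integrable_jump_kernel[OF K w, of "Im z"]) (use z in \<open>auto simp: upper_strip_def\<close>)
  have i2: "integrable K (\<lambda>x. exp (\<i> * (\<i> * of_real (Im z)) * of_real x) - 1 - \<i> * (\<i> * of_real (Im z)) * of_real x)"
    by (rule integrable_jump_kernel[OF K w, of "Im z"]) (use z in \<open>auto simp: upper_strip_def\<close>)
  have *: "Re (exp (\<i> * z * of_real x)) \<le> Re (exp (\<i> * (\<i> * of_real (Im z)) * of_real x))" for x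
    by (simp add: Re_exp)
  show ?thesis
    unfolding jump_exponent_def integral_Re[OF i1, symmetric] integral_Re[OF i2, symmetric]
    using * by (intro integral_mono integrable_Re i1 i2) (auto simp: diff_right_mono)
qed

section \<open>Contour shift and Gaussian damping\<close>

lemma integral_std_normal_distribution:
  fixes f :: "real \<Rightarrow> complex"
  assumes [measurable]: "f \<in> borel_measurable borel"
  shows "(\<integral>x. f x \<partial>std_normal_distribution) = (\<integral>x. of_real (std_normal_density x) * f x \<partial>lborel)"
  by (subst integral_density) (auto simp: scaleR_conv_of_real)

text \<open>A primitive \<open>H\<close> replaces the contour integral over a rectangle: the
  integrals over horizontal lines are limits of increments of \<open>H\<close> between the abscissas
  \<open>- N\<close> and \<open>N\<close>, and the increments along the vertical sides tend to 0 by
  the Gaussian bound.\<close>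

lemma contour_shift:
  fixes h :: "complex \<Rightarrow> complex"
  assumes a: "0 \<le> a"
    and h: "\<And>z. z \<in> upper_strip a \<Longrightarrow> h field_differentiable (at z within upper_strip a)"
    and bound: "\<And>z. z \<in> upper_strip a \<Longrightarrow> norm (h z) \<le> C * std_normal_density (Re z)"
  shows "(\<integral>x. h (of_real x) \<partial>lborel) = (\<integral>x. h (of_real x + \<i> * of_real a) \<partial>lborel)"
proof -
  let ?S = "upper_strip a"
  have cont: "continuous_on ?S h"
    using h by (auto simp: continuous_on_eq_continuous_within field_differentiable_imp_continuous_at)
  \<comment> \<open>Holomorphy in the interior and continuity up to the boundary yield a primitive
    on the closed strip, so that both edges may be used.\<close>
  have "h field_differentiable at z" if "z \<in> interior ?S - {}" for z
    using that h[of z] interior_subset[of ?S] at_within_interior[of z ?S] by (metis DiffD1 subsetD)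
  then obtain H where H: "\<And>z. z \<in> ?S \<Longrightarrow> (H has_field_derivative h z) (at z within ?S)"
    using holomorphic_convex_primitive[OF convex_upper_strip finite.emptyI cont] by blast
  have line: "(\<lambda>N. H (of_real (real N) + \<i> * of_real b) - H (of_real (- real N) + \<i> * of_real b))
      \<longlonglongrightarrow> (\<integral>x. h (of_real x + \<i> * of_real b) \<partial>lborel)" if b: "0 \<le> b" "b \<le> a" for b
  proof -
    let ?l = "\<lambda>x::real. of_real x + \<i> * of_real b :: complex"
    have l: "?l x \<in> ?S" for x using b by (simp add: upper_strip_def)
    have ch: "continuous_on UNIV (\<lambda>x. h (?l x))"
      by (rule continuous_on_compose2[OF cont]) (use l in \<open>auto intro!: continuous_intros\<close>)
    have [measurable]: "(\<lambda>x. h (?l x)) \<in> borel_measurable borel"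
      using ch by (rule borel_measurable_continuous_onI)
    have "(LINT x|lborel. indicator {- real N..real N} x *\<^sub>R h (?l x)) = H (?l (real N)) - H (?l (- real N))" for N
    proof (rule integral_FTC_Icc)
      fix x assume "- real N \<le> x" "x \<le> real N"
      have "((\<lambda>x. ?l x) has_vector_derivative 1) (at x within {- real N..real N})"
        by (auto intro!: derivative_eq_intros simp: has_vector_derivative_def scaleR_conv_of_real)
      then have "(H \<circ> ?l has_vector_derivative 1 * h (?l x)) (at x within {- real N..real N})"
        by (rule field_vector_diff_chain_within)
           (rule DERIV_subset[OF H[OF l]], use l in auto)
      then show "((\<lambda>x. H (?l x)) has_vector_derivative h (?l x)) (at x within {- real N..real N})"
        by (simp add: comp_def)
    qed (use ch continuous_on_subset in auto)
    moreover have "(\<lambda>N. LINT x|lborel. indicator {- real N..real N} x *\<^sub>R h (?l x))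
        \<longlonglongrightarrow> (\<integral>x. h (?l x) \<partial>lborel)"
    proof (rule integral_dominated_convergence[where w="\<lambda>x. C * std_normal_density x"])
      show "AE x in lborel. (\<lambda>N. indicator {- real N..real N} x *\<^sub>R h (?l x)) \<longlonglongrightarrow> h (?l x)"
      proof (rule AE_I2)
        fix x
        have "eventually (\<lambda>N. indicator {- real N..real N} x *\<^sub>R h (?l x) = h (?l x)) sequentially"
          using eventually_ge_at_top[of "nat \<lceil>\<bar>x\<bar>\<rceil>"]
          by eventually_elim (auto simp: indicator_def)
        then show "(\<lambda>N. indicator {- real N..real N} x *\<^sub>R h (?l x)) \<longlonglongrightarrow> h (?l x)"
          by (rule tendsto_eventually)
      qed
      show "AE x in lborel. norm (indicator {- real N..real N} x *\<^sub>R h (?l x)) \<le> C * std_normal_density x" for N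
      proof (rule AE_I2)
        fix x
        have "norm (h (?l x)) \<le> C * std_normal_density x" using bound[OF l[of x]] by simp
        then show "norm (indicator {- real N..real N} x *\<^sub>R h (?l x)) \<le> C * std_normal_density x"
          using norm_ge_zero[of "h (?l x)"] by (auto simp: indicator_def simp del: norm_ge_zero)
      qed
      show "integrable lborel (\<lambda>x. C * std_normal_density x)"
        by (intro integrable_mult_right integrable_normal_density) simp
    qed auto
    ultimately show ?thesis by simp
  qed
  have side: "(\<lambda>N. H (of_real (X N) + \<i> * of_real a) - H (of_real (X N))) \<longlonglongrightarrow> 0"
    if X: "\<And>N. \<bar>X N\<bar> = real N" for X :: "nat \<Rightarrow> real"
  proof (rule Lim_null_comparison)
    show "eventually (\<lambda>N. norm (H (of_real (X N) + \<i> * of_real a) - H (of_real (X N)))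
        \<le> C * std_normal_density (real N) * a) sequentially"
    proof (intro always_eventually allI)
      fix N
      let ?L = "?S \<inter> {z. Re z = X N}"
      have "convex ?L"
      proof (rule convex_Int[OF convex_upper_strip])
        have "{z. Re z = X N} = {z. Re z \<le> X N} \<inter> {z. Re z \<ge> X N}" by auto
        then show "convex {z. Re z = X N}"
          by (simp add: convex_Int convex_halfspace_Re_ge convex_halfspace_Re_le)
      qed
      then have "norm (H (of_real (X N) + \<i> * of_real a) - H (of_real (X N)))
        \<le> C * std_normal_density (X N) * norm ((of_real (X N) + \<i> * of_real a) - of_real (X N) :: complex)"
      proof (rule field_differentiable_bound)
        fix z assume z: "z \<in> ?L"
        then show "(H has_field_derivative h z) (at z within ?L)"
          using H[of z] by (auto intro: DERIV_subset)
        show "norm (h z) \<le> C * std_normal_density (X N)" using bound[of z] z by simp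
      qed (use a in \<open>auto simp: upper_strip_def\<close>)
      moreover have "(X N)\<^sup>2 = (real N)\<^sup>2" using X[of N] by (metis power2_abs)
      ultimately show "norm (H (of_real (X N) + \<i> * of_real a) - H (of_real (X N)))
        \<le> C * std_normal_density (real N) * a"
        using a by (simp add: norm_mult std_normal_density_def)
    qed
    have "(\<lambda>N. exp (- (real N)\<^sup>2 / 2)) \<longlonglongrightarrow> 0" by real_asymp
    then show "(\<lambda>N. C * std_normal_density (real N) * a) \<longlonglongrightarrow> 0"
      unfolding std_normal_density_def
      by (intro tendsto_mult_left_zero tendsto_mult_right_zero)
  qed
  \<comment> \<open>The corner values at height \<open>a\<close> cancel, which leaves the increment
    along the real axis.\<close>
  have "(\<lambda>N. (H (of_real (real N) + \<i> * of_real a) - H (of_real (- real N) + \<i> * of_real a))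
      - ((H (of_real (real N) + \<i> * of_real a) - H (of_real (real N)))
      - (H (of_real (- real N) + \<i> * of_real a) - H (of_real (- real N)))))
      \<longlonglongrightarrow> (\<integral>x. h (of_real x + \<i> * of_real a) \<partial>lborel) - (0 - 0)"
    by (intro tendsto_diff line side) (use a in auto)
  moreover have "(\<lambda>N. H (of_real (real N)) - H (of_real (- real N)))
      \<longlonglongrightarrow> (\<integral>x. h (of_real x) \<partial>lborel)"
    using line[of 0] a by simp
  ultimately show ?thesis
    by (intro LIMSEQ_unique) (simp_all add: algebra_simps)
qed

text \<open>The damped exponential is itself a Gaussian average of characters:
  with \<open>N\<close> standard normal, \<open>exp (- a x - s\<^sup>2 x\<^sup>2 / 2) = \<integral> exp (\<i> y (s x + b)) exp (b\<^sup>2 / 2) dN y\<close>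
  where \<open>s b = a\<close>. Integrating over \<open>x\<close> produces \<open>\<phi> (s y)\<close>, and shifting the contour by
  \<open>\<i> b\<close> cancels the remaining factors.\<close>

lemma (in real_distribution) gaussian_damped_laplace:
  fixes \<phi> :: "complex \<Rightarrow> complex"
  assumes a: "0 \<le> a" and s: "0 < s"
    and diff: "\<And>z. z \<in> upper_strip a \<Longrightarrow> \<phi> field_differentiable (at z within upper_strip a)"
    and bound: "\<And>z. z \<in> upper_strip a \<Longrightarrow> norm (\<phi> z) \<le> B"
    and char: "\<And>u. char M u = \<phi> (of_real u)"
  shows "(\<integral>y. \<phi> (of_real (s * y) + \<i> * of_real a) \<partial>std_normal_distribution) =
    of_real (\<integral>x. exp (- a * x - s\<^sup>2 * x\<^sup>2 / 2) \<partial>M)"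
proof -
  interpret N: real_distribution std_normal_distribution by (rule real_dist_normal_dist)
  interpret NM: pair_prob_space std_normal_distribution M ..
  \<comment> \<open>The argument of \<open>\<phi>\<close> is \<open>s * y\<close>, so a shift of
    \<open>y\<close> by \<open>\<i> * b\<close> moves it by \<open>\<i> * a\<close>.\<close>
  define b where "b = a / s"
  have b: "0 \<le> b" "s * b = a" using a s by (simp_all add: b_def)
  define f where "f y x = exp (\<i> * of_real (y * (s * x + b))) * of_real (exp (b\<^sup>2 / 2))"
    for y x :: real
  \<comment> \<open>\<open>h\<close> includes the Gaussian weight: its exponential factor is
    \<open>exp (- z\<^sup>2 / 2) * exp (\<i> * z * b) * exp (b\<^sup>2 / 2)\<close>, and at
    \<open>z = y + \<i> * b\<close> only the normal density and \<open>\<phi>\<close> are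
    left.\<close>
  define h where "h z = \<phi> (of_real s * z) * exp (- (z - \<i> * of_real b)\<^sup>2 / 2) / of_real (sqrt (2 * pi))"
    for z
  have scale: "of_real s * z \<in> upper_strip a" if "z \<in> upper_strip b" for z
    using that s b(2) by (auto simp: upper_strip_def intro: mult_left_mono)
  have cont: "continuous_on (upper_strip a) \<phi>"
    using diff by (auto simp: continuous_on_eq_continuous_within field_differentiable_imp_continuous_at)
  have line: "of_real (s * y) + \<i> * of_real r \<in> upper_strip a" if "0 \<le> r" "r \<le> a" for y r
    using that by (simp add: upper_strip_def)
  have meas: "(\<lambda>y. \<phi> (of_real (s * y) + \<i> * of_real r)) \<in> borel_measurable borel"
    if "0 \<le> r" "r \<le> a" for r
    by (intro borel_measurable_continuous_onI continuous_on_compose2[OF cont])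
       (use line[OF that] in \<open>auto intro!: continuous_intros\<close>)
  have "of_real (\<integral>x. exp (- a * x - s\<^sup>2 * x\<^sup>2 / 2) \<partial>M) =
      (\<integral>x. of_real (exp (- a * x - s\<^sup>2 * x\<^sup>2 / 2)) \<partial>M :: complex)"
    by (rule integral_complex_of_real[symmetric])
  also have "\<dots> = (\<integral>x. (\<integral>y. f y x \<partial>std_normal_distribution) \<partial>M)"
  proof (rule Bochner_Integration.integral_cong[OF refl])
    fix x
    have "(\<integral>y. f y x \<partial>std_normal_distribution) = char std_normal_distribution (s * x + b) * of_real (exp (b\<^sup>2 / 2))"
      by (simp add: f_def char_def mult.commute)
    also have "\<dots> = of_real (exp (- ((s * x + b)\<^sup>2 / 2) + b\<^sup>2 / 2))"
      by (simp add: char_std_normal_distribution exp_add[symmetric] flip: of_real_mult of_real_exp)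
    also have "- ((s * x + b)\<^sup>2 / 2) + b\<^sup>2 / 2 = - a * x - s\<^sup>2 * x\<^sup>2 / 2"
      by (simp add: power2_eq_square field_simps flip: b(2))
    finally show "of_real (exp (- a * x - s\<^sup>2 * x\<^sup>2 / 2)) = (\<integral>y. f y x \<partial>std_normal_distribution)" ..
  qed
  also have "\<dots> = (\<integral>y. (\<integral>x. f y x \<partial>M) \<partial>std_normal_distribution)"
  proof (rule NM.Fubini_integral)
    show "integrable (std_normal_distribution \<Otimes>\<^sub>M M) (\<lambda>(x, y). f x y)"
    proof (rule NM.P.integrable_const_bound[where B="exp (b\<^sup>2 / 2)"])
      show "(\<lambda>(x, y). f x y) \<in> borel_measurable (std_normal_distribution \<Otimes>\<^sub>M M)"
        unfolding f_def by measurable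
    qed (auto simp: f_def norm_mult)
  qed
  also have "\<dots> = (\<integral>y. \<phi> (of_real (s * y)) * exp (\<i> * of_real (y * b)) * of_real (exp (b\<^sup>2 / 2))
      \<partial>std_normal_distribution)"
  proof (rule Bochner_Integration.integral_cong[OF refl])
    fix y
    have "(\<integral>x. f y x \<partial>M) = (\<integral>x. exp (\<i> * of_real (s * y * x)) * (exp (\<i> * of_real (y * b)) * of_real (exp (b\<^sup>2 / 2))) \<partial>M)"
      by (rule Bochner_Integration.integral_cong[OF refl])
         (simp add: f_def exp_add[symmetric] algebra_simps)
    also have "\<dots> = char M (s * y) * (exp (\<i> * of_real (y * b)) * of_real (exp (b\<^sup>2 / 2)))"
      by (simp add: char_def)
    finally show "(\<integral>x. f y x \<partial>M) = \<phi> (of_real (s * y)) * exp (\<i> * of_real (y * b)) * of_real (exp (b\<^sup>2 / 2))"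
      by (simp add: char mult.assoc)
  qed
  also have "\<dots> = (\<integral>y. h (of_real y) \<partial>lborel)"
  proof (subst integral_std_normal_distribution)
    show "(\<lambda>y. \<phi> (of_real (s * y)) * exp (\<i> * of_real (y * b)) * of_real (exp (b\<^sup>2 / 2))) \<in> borel_measurable borel"
      using meas[of 0] a by simp
    have e: "exp (- (of_real y - \<i> * of_real b)\<^sup>2 / 2) =
        of_real (exp (- y\<^sup>2 / 2)) * (exp (\<i> * of_real (y * b)) * of_real (exp (b\<^sup>2 / 2)))" for y
      unfolding exp_of_real[symmetric] exp_add[symmetric]
      by (rule arg_cong[where f=exp]) (simp add: power2_eq_square field_simps)
    show "(\<integral>y. of_real (std_normal_density y) * (\<phi> (of_real (s * y)) * exp (\<i> * of_real (y * b)) * of_real (exp (b\<^sup>2 / 2))) \<partial>lborel)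
        = (\<integral>y. h (of_real y) \<partial>lborel)"
    proof (rule Bochner_Integration.integral_cong[OF refl])
      fix y
      show "of_real (std_normal_density y) * (\<phi> (of_real (s * y)) * exp (\<i> * of_real (y * b)) * of_real (exp (b\<^sup>2 / 2))) = h (of_real y)"
        unfolding h_def e std_normal_density_def of_real_mult of_real_divide of_real_1
        by (simp only: mult_ac times_divide_eq_left times_divide_eq_right mult_1_left mult_1_right)
    qed
  qed
  also have "\<dots> = (\<integral>y. h (of_real y + \<i> * of_real b) \<partial>lborel)"
  proof (rule contour_shift[OF b(1)])
    fix z assume z: "z \<in> upper_strip b"
    have "((\<lambda>z. of_real s * z) has_field_derivative of_real s) (at z within upper_strip b)"
      by (auto intro!: derivative_eq_intros)
    moreover obtain D where "(\<phi> has_field_derivative D) (at (of_real s * z) within upper_strip a)"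
      using diff[OF scale[OF z]] by (auto simp: field_differentiable_def)
    then have "(\<phi> has_field_derivative D) (at (of_real s * z) within (\<lambda>z. of_real s * z) ` upper_strip b)"
      by (rule DERIV_subset) (use scale in auto)
    ultimately have "(\<phi> \<circ> (\<lambda>z. of_real s * z) has_field_derivative D * of_real s) (at z within upper_strip b)"
      by (intro DERIV_image_chain)
    then have "(\<lambda>z. \<phi> (of_real s * z)) field_differentiable (at z within upper_strip b)"
      by (auto simp: field_differentiable_def comp_def)
    moreover have "(\<lambda>z. exp (- (z - \<i> * of_real b)\<^sup>2 / 2)) field_differentiable (at z within upper_strip b)"
    proof -
      have "((\<lambda>z. exp (- (z - \<i> * of_real b)\<^sup>2 / 2)) has_field_derivative
          exp (- (z - \<i> * of_real b)\<^sup>2 / 2) * (- (z - \<i> * of_real b))) (at z within upper_strip b)"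
        by (auto intro!: derivative_eq_intros simp: field_simps)
      then show ?thesis by (auto simp: field_differentiable_def)
    qed
    ultimately show "h field_differentiable (at z within upper_strip b)"
      unfolding h_def[abs_def]
      by (intro field_differentiable_divide field_differentiable_mult field_differentiable_const) auto
    have "(Im z - b)\<^sup>2 \<le> b\<^sup>2"
      using z by (intro power2_le_iff_abs_le[THEN iffD2]) (auto simp: upper_strip_def)
    moreover have "Re (- (z - \<i> * of_real b)\<^sup>2 / 2) = (Im z - b)\<^sup>2 / 2 + - (Re z)\<^sup>2 / 2"
      by (simp add: power2_eq_square field_simps)
    ultimately have "norm (exp (- (z - \<i> * of_real b)\<^sup>2 / 2)) \<le> exp (b\<^sup>2 / 2) * exp (- (Re z)\<^sup>2 / 2)"
      unfolding norm_exp_eq_Re exp_add[symmetric] by simp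
    moreover have "norm (\<phi> (of_real s * z)) \<le> B" using bound[OF scale[OF z]] .
    ultimately have "norm (\<phi> (of_real s * z)) * norm (exp (- (z - \<i> * of_real b)\<^sup>2 / 2)) / sqrt (2 * pi)
        \<le> B * (exp (b\<^sup>2 / 2) * exp (- (Re z)\<^sup>2 / 2)) / sqrt (2 * pi)"
      by (intro divide_right_mono mult_mono') auto
    then show "norm (h z) \<le> (B * exp (b\<^sup>2 / 2)) * std_normal_density (Re z)"
      unfolding h_def norm_mult norm_divide std_normal_density_def
      by (simp only: norm_of_real abs_of_nonneg real_sqrt_ge_zero mult_ac times_divide_eq_right
          times_divide_eq_left mult_1_left) simp
  qed
  also have "\<dots> = (\<integral>y. \<phi> (of_real (s * y) + \<i> * of_real a) \<partial>std_normal_distribution)"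
  proof (subst integral_std_normal_distribution)
    show "(\<lambda>y. \<phi> (of_real (s * y) + \<i> * of_real a)) \<in> borel_measurable borel"
      using meas[of a] a by simp
    show "(\<integral>y. h (of_real y + \<i> * of_real b) \<partial>lborel) =
        (\<integral>y. of_real (std_normal_density y) * \<phi> (of_real (s * y) + \<i> * of_real a) \<partial>lborel)"
    proof (rule Bochner_Integration.integral_cong[OF refl])
      fix y
      have "of_real s * (of_real y + \<i> * of_real b) = of_real (s * y) + \<i> * (of_real a :: complex)"
        unfolding b(2)[symmetric] by (simp add: algebra_simps)
      moreover have "exp (- (of_real y)\<^sup>2 / 2) = (of_real (exp (- y\<^sup>2 / 2)) :: complex)"
        unfolding exp_of_real[symmetric] by simp
      ultimately show "h (of_real y + \<i> * of_real b) =
          of_real (std_normal_density y) * \<phi> (of_real (s * y) + \<i> * of_real a)"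
        by (simp add: h_def std_normal_density_def)
    qed
  qed
  finally show ?thesis ..
qed

text \<open>The damping \<open>s\<close> tends to 0. Under \<open>M\<close> the damped exponentials
  increase, so monotone convergence applies; on the side of \<open>\<phi>\<close> the bound
  \<open>B\<close> gives dominated convergence. Finiteness of the moment is thus a
  conclusion.\<close>

lemma (in real_distribution) laplace_from_char_extension:
  fixes \<phi> :: "complex \<Rightarrow> complex"
  assumes a: "0 \<le> a"
    and diff: "\<And>z. z \<in> upper_strip a \<Longrightarrow> \<phi> field_differentiable (at z within upper_strip a)"
    and bound: "\<And>z. z \<in> upper_strip a \<Longrightarrow> norm (\<phi> z) \<le> B"
    and char: "\<And>u. char M u = \<phi> (of_real u)"
  shows "(\<integral>\<^sup>+x. ennreal (exp (- a * x)) \<partial>M) = ennreal (Re (\<phi> (\<i> * of_real a)))"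
proof (rule LIMSEQ_unique)
  interpret N: real_distribution std_normal_distribution by (rule real_dist_normal_dist)
  define s where "s k = inverse (real (Suc k))" for k
  have s: "0 < s k" for k by (simp add: s_def)
  have s0: "s \<longlonglongrightarrow> 0" unfolding s_def[abs_def] by (rule LIMSEQ_inverse_real_of_nat)
  define g where "g k x = exp (- a * x - (s k)\<^sup>2 * x\<^sup>2 / 2)" for k x
  have nn: "(\<integral>\<^sup>+x. ennreal (g k x) \<partial>M) = ennreal (\<integral>x. g k x \<partial>M)" for k
  proof (rule nn_integral_eq_integral)
    show "integrable M (g k)"
    proof (rule integrable_const_bound[where B="exp ((a / s k)\<^sup>2 / 2)"])
      show "AE x in M. norm (g k x) \<le> exp ((a / s k)\<^sup>2 / 2)"
      proof (rule AE_I2)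
        fix x
        \<comment> \<open>Completing the square bounds the exponent in \<open>g k x\<close> by a
          constant that may depend on \<open>k\<close>.\<close>
        have "0 \<le> (s k * x + a / s k)\<^sup>2" by simp
        also have "\<dots> = (s k)\<^sup>2 * x\<^sup>2 + 2 * a * x + (a / s k)\<^sup>2"
          using s[of k] by (simp add: power2_eq_square field_simps)
        finally show "norm (g k x) \<le> exp ((a / s k)\<^sup>2 / 2)" by (simp add: g_def)
      qed
    qed (simp add: g_def[abs_def])
  qed (simp add: g_def)
  have cont: "continuous_on (upper_strip a) \<phi>"
    using diff by (auto simp: continuous_on_eq_continuous_within field_differentiable_imp_continuous_at)
  have line: "of_real r + \<i> * of_real a \<in> upper_strip a" for r
    using a by (simp add: upper_strip_def)
  show "(\<lambda>k. \<integral>\<^sup>+x. ennreal (g k x) \<partial>M) \<longlonglongrightarrow> (\<integral>\<^sup>+x. ennreal (exp (- a * x)) \<partial>M)"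
  proof (rule nn_integral_LIMSEQ)
    show "incseq (\<lambda>k x. ennreal (g k x))"
    proof (intro incseq_SucI le_funI)
      fix k x
      have "(s (Suc k))\<^sup>2 \<le> (s k)\<^sup>2"
        by (intro power_mono) (auto simp: s_def field_simps)
      then have "(s (Suc k))\<^sup>2 * x\<^sup>2 \<le> (s k)\<^sup>2 * x\<^sup>2" by (rule mult_right_mono) simp
      then show "ennreal (g k x) \<le> ennreal (g (Suc k) x)"
        by (intro ennreal_leI) (simp add: g_def)
    qed
    show "(\<lambda>k. ennreal (g k x)) \<longlonglongrightarrow> ennreal (exp (- a * x))" for x
    proof (rule tendsto_ennrealI)
      have "(\<lambda>k. exp (- a * x - (s k)\<^sup>2 * x\<^sup>2 / 2)) \<longlonglongrightarrow> exp (- a * x - 0\<^sup>2 * x\<^sup>2 / 2)"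
        by (intro tendsto_intros s0) auto
      then show "(\<lambda>k. g k x) \<longlonglongrightarrow> exp (- a * x)" by (simp add: g_def)
    qed
  qed (simp add: g_def)
  have "(\<lambda>k. \<integral>y. \<phi> (of_real (s k * y) + \<i> * of_real a) \<partial>std_normal_distribution)
      \<longlonglongrightarrow> (\<integral>y. \<phi> (\<i> * of_real a) \<partial>std_normal_distribution)"
  proof (rule integral_dominated_convergence[where w="\<lambda>_. B"])
    show "(\<lambda>y. \<phi> (of_real (s k * y) + \<i> * of_real a)) \<in> borel_measurable std_normal_distribution" for k
    proof -
      have "(\<lambda>y. \<phi> (of_real (s k * y) + \<i> * of_real a)) \<in> borel_measurable borel"
        by (intro borel_measurable_continuous_onI continuous_on_compose2[OF cont])
           (use line in \<open>auto intro!: continuous_intros simp del: of_real_mult\<close>)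
      then show ?thesis by simp
    qed
    show "AE y in std_normal_distribution.
        (\<lambda>k. \<phi> (of_real (s k * y) + \<i> * of_real a)) \<longlonglongrightarrow> \<phi> (\<i> * of_real a)"
    proof (rule AE_I2)
      fix y
      have "(\<lambda>k. of_real (s k * y) + \<i> * of_real a :: complex) \<longlonglongrightarrow> of_real (0 * y) + \<i> * of_real a"
        by (intro tendsto_intros s0)
      then have lim: "(\<lambda>k. of_real (s k * y) + \<i> * of_real a :: complex) \<longlonglongrightarrow> \<i> * of_real a" by simp
      show "(\<lambda>k. \<phi> (of_real (s k * y) + \<i> * of_real a)) \<longlonglongrightarrow> \<phi> (\<i> * of_real a)"
        by (rule continuous_on_tendsto_compose[OF cont lim]) (use line line[of 0] in \<open>auto simp del: of_real_mult\<close>)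
    qed
    show "AE y in std_normal_distribution. norm (\<phi> (of_real (s k * y) + \<i> * of_real a)) \<le> B" for k
      by (intro AE_I2 bound line)
  qed auto
  moreover have "(\<integral>y. \<phi> (of_real (s k * y) + \<i> * of_real a) \<partial>std_normal_distribution) =
      complex_of_real (\<integral>x. g k x \<partial>M)" for k
    unfolding g_def by (rule gaussian_damped_laplace[OF a s diff bound char])
  moreover have "(\<integral>y. \<phi> (\<i> * of_real a) \<partial>std_normal_distribution) = \<phi> (\<i> * of_real a)"
    using N.prob_space by simp
  ultimately have "(\<lambda>k. complex_of_real (\<integral>x. g k x \<partial>M)) \<longlonglongrightarrow> \<phi> (\<i> * of_real a)"
    by (simp only:)
  from tendsto_Re[OF this] have "(\<lambda>k. \<integral>x. g k x \<partial>M) \<longlonglongrightarrow> Re (\<phi> (\<i> * of_real a))" by simp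
  then show "(\<lambda>k. \<integral>\<^sup>+x. ennreal (g k x) \<partial>M) \<longlonglongrightarrow> ennreal (Re (\<phi> (\<i> * of_real a)))"
    unfolding nn by (rule tendsto_ennrealI)
qed

section \<open>Laplace exponent of a Levy process\<close>

lemma integrable_jump_weight:
  assumes K: "sets K = sets borel"
    and 1: "(\<integral>\<^sup>+x. ennreal (min (x\<^sup>2) \<bar>x\<bar>) \<partial>K) < \<infinity>"
    and 2: "(\<integral>\<^sup>+x\<in>{..<-1}. ennreal (exp (- A * x)) \<partial>K) < \<infinity>"
  shows "integrable K (jump_weight A)"
proof -
  note [measurable_cong] = K
  have "integrable K (\<lambda>x. min (x\<^sup>2) \<bar>x\<bar>)"
    by (rule integrableI_nonneg) (use 1 in auto)
  moreover have "integrable K (\<lambda>x. indicator {..<-1} x * exp (- A * x))"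
  proof (rule integrableI_nonneg)
    have "(\<integral>\<^sup>+x. ennreal (indicator {..<-1} x * exp (- A * x)) \<partial>K) =
        (\<integral>\<^sup>+x\<in>{..<-1}. ennreal (exp (- A * x)) \<partial>K)"
      by (rule nn_integral_cong) (simp add: indicator_def)
    then show "(\<integral>\<^sup>+x. ennreal (indicator {..<-1} x * exp (- A * x)) \<partial>K) < \<infinity>" using 2 by simp
  qed auto
  ultimately show ?thesis unfolding jump_weight_def[abs_def] by simp
qed

text \<open>With \<open>\<psi>\<close> the Levy-Khintchine exponent at complex arguments,
  \<open>\<phi> z = exp (t * \<psi> z)\<close> extends the characteristic function of
  \<open>X t\<close> to the strip, and \<open>\<psi> (\<i> * a)\<close> is the negative of the
  Laplace exponent.\<close>

lemma (in levy_process) exponential_moment: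
  assumes par: "has_levy_parameters M X b c K"
    and 1: "(\<integral>\<^sup>+x. ennreal (min (x\<^sup>2) \<bar>x\<bar>) \<partial>K) < \<infinity>"
    and 2: "(\<integral>\<^sup>+x\<in>{..<-1}. ennreal (exp (- A * x)) \<partial>K) < \<infinity>"
    and a: "0 \<le> a" "a < A" and t: "0 \<le> t"
  shows "(\<integral>\<^sup>+\<omega>. ennreal (exp (- a * X t \<omega>)) \<partial>M) = ennreal (exp (- t * laplace_exponent b c K a))"
proof -
  have c: "0 \<le> c" and K: "sets K = sets borel"
    and char: "char (distr M borel (X t)) u = exp (of_real t * (\<i> * of_real (u * b) - of_real (u\<^sup>2 * c / 2) +
        (\<integral>x. (exp (\<i> * of_real (u * x)) - 1 - \<i> * of_real (u * x)) \<partial>K)))" for u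
    using par t unfolding has_levy_parameters_def levy_measure_def by auto
  have w: "integrable K (jump_weight A)" by (rule integrable_jump_weight[OF K 1 2])
  interpret D: real_distribution "distr M borel (X t)"
    by (rule real_distribution_distr) (rule measurable_X[OF t])
  define \<psi> where "\<psi> z = \<i> * z * of_real b - z\<^sup>2 * of_real c / 2 + jump_exponent K z" for z
  define \<phi> where "\<phi> z = exp (of_real t * \<psi> z)" for z
  have diff\<psi>: "\<psi> field_differentiable (at z within upper_strip a)" if "z \<in> upper_strip a" for z
  proof -
    have "jump_exponent K field_differentiable (at z within upper_strip a)"
      using jump_exponent_derivative[OF K w a that] by (auto simp: field_differentiable_def)
    moreover have "((\<lambda>z. \<i> * z * of_real b - z\<^sup>2 * of_real c / 2) has_field_derivative
        \<i> * of_real b - z * of_real c) (at z within upper_strip a)"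
      by (auto intro!: derivative_eq_intros)
    then have "(\<lambda>z. \<i> * z * of_real b - z\<^sup>2 * of_real c / 2) field_differentiable (at z within upper_strip a)"
      by (auto simp: field_differentiable_def)
    ultimately show ?thesis
      unfolding \<psi>_def[abs_def] by (intro field_differentiable_add)
  qed
  have cont: "continuous_on (upper_strip a) \<psi>"
    using diff\<psi> by (auto simp: continuous_on_eq_continuous_within field_differentiable_imp_continuous_at)
  \<comment> \<open>Compactness bounds \<open>\<psi>\<close> on the imaginary segment; elsewhere in
    the strip its real part is no larger than at the same height on that segment.\<close>
  have "compact ((\<lambda>r. Re (\<psi> (\<i> * of_real r))) ` {0..a})"
    by (intro compact_continuous_image continuous_intros continuous_on_compose2[OF cont])
       (auto simp: upper_strip_def)
  then obtain B where B: "\<And>r. 0 \<le> r \<Longrightarrow> r \<le> a \<Longrightarrow> \<bar>Re (\<psi> (\<i> * of_real r))\<bar> \<le> B"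
    unfolding compact_eq_bounded_closed bounded_iff by fastforce
  have bound: "norm (\<phi> z) \<le> exp (t * B)" if z: "z \<in> upper_strip a" for z
  proof -
    have "Re (\<psi> z) \<le> Re (\<psi> (\<i> * of_real (Im z)))"
    proof -
      have "Re (jump_exponent K z) \<le> Re (jump_exponent K (\<i> * of_real (Im z)))"
        by (rule Re_jump_exponent_le[OF K w]) (use z a in \<open>auto simp: upper_strip_def\<close>)
      \<comment> \<open>Off the imaginary axis the Gaussian term adds
        \<open>- (Re z)\<^sup>2 * c / 2\<close> to the real part.\<close>
      moreover have "0 \<le> (Re z)\<^sup>2 * c" using c by simp
      ultimately show ?thesis
        by (simp add: \<psi>_def power2_eq_square algebra_simps diff_divide_distrib)
    qed
    also have "\<dots> \<le> B" using B[of "Im z"] z by (simp add: upper_strip_def)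
    finally show ?thesis using t by (simp add: \<phi>_def mult_left_mono)
  qed
  have diff: "\<phi> field_differentiable (at z within upper_strip a)" if z: "z \<in> upper_strip a" for z
  proof -
    obtain D where [derivative_intros]: "(\<psi> has_field_derivative D) (at z within upper_strip a)"
      using diff\<psi>[OF z] by (auto simp: field_differentiable_def)
    have "(\<phi> has_field_derivative exp (of_real t * \<psi> z) * (of_real t * D)) (at z within upper_strip a)"
      unfolding \<phi>_def[abs_def] by (auto intro!: derivative_eq_intros)
    then show ?thesis by (auto simp: field_differentiable_def)
  qed
  have "char (distr M borel (X t)) u = \<phi> (of_real u)" for u
    unfolding char \<phi>_def \<psi>_def jump_exponent_def by (simp add: mult_ac)
  from D.laplace_from_char_extension[OF a(1) diff bound this]
  have "(\<integral>\<^sup>+x. ennreal (exp (- a * x)) \<partial>distr M borel (X t)) = ennreal (Re (\<phi> (\<i> * of_real a)))" by simp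
  also have "(\<integral>\<^sup>+x. ennreal (exp (- a * x)) \<partial>distr M borel (X t)) = (\<integral>\<^sup>+\<omega>. ennreal (exp (- a * X t \<omega>)) \<partial>M)"
    using measurable_X[OF t] by (subst nn_integral_distr) auto
  also have "\<phi> (\<i> * of_real a) = of_real (exp (- t * laplace_exponent b c K a))"
  proof -
    have "jump_exponent K (\<i> * of_real a) = (\<integral>x. of_real (exp (- a * x) - 1 + a * x) \<partial>K)"
      unfolding jump_exponent_def
      by (rule Bochner_Integration.integral_cong[OF refl])
         (simp add: exp_of_real[symmetric] flip: mult.assoc)
    also have "\<dots> = of_real (\<integral>x. exp (- a * x) - 1 + a * x \<partial>K)"
      by (rule integral_complex_of_real)
    finally have "\<psi> (\<i> * of_real a) = of_real (- laplace_exponent b c K a)"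
      by (simp add: \<psi>_def laplace_exponent_def power_mult_distrib flip: mult.assoc)
    then show ?thesis by (simp add: \<phi>_def exp_of_real[symmetric])
  qed
  finally show ?thesis by simp
qed

section \<open>Integrals over simplices\<close>

text \<open>The integral of \<open>f u1 * ... * f um\<close> over
  \<open>s \<le> u1 \<le> ... \<le> um \<le> t\<close>. The smallest variable is outermost, so that
  times are fixed in increasing order.\<close>

fun simplex_integral :: "(real \<Rightarrow> ennreal) \<Rightarrow> real \<Rightarrow> nat \<Rightarrow> real \<Rightarrow> ennreal" where
  "simplex_integral f t 0 s = 1"
| "simplex_integral f t (Suc m) s =
    (\<integral>\<^sup>+u. indicator {s..t} u * (f u * simplex_integral f t m u) \<partial>lborel)"

lemma simplex_integral_measurable [measurable]:
  assumes [measurable]: "f \<in> borel_measurable borel"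
  shows "simplex_integral f t m \<in> borel_measurable borel"
proof (induction m)
  case (Suc m)
  note [measurable] = Suc.IH
  have [measurable]: "Measurable.pred (borel \<Otimes>\<^sub>M lborel) (\<lambda>(s, u). u \<in> {s..t})"
    unfolding atLeastAtMost_iff by measurable
  show ?case
    unfolding simplex_integral.simps[abs_def]
    by (rule lborel.borel_measurable_nn_integral) measurable
qed simp

text \<open>A further variable \<open>v\<close> can be inserted at \<open>m + 1\<close> places. If
  it precedes the first variable \<open>u\<close>, it starts a longer simplex; otherwise Tonelli
  moves \<open>u\<close> outside and the induction hypothesis applies with lower limit
  \<open>u\<close>.\<close>

lemma simplex_integral_mult:
  assumes [measurable]: "f \<in> borel_measurable borel"
  shows "simplex_integral f t 1 s * simplex_integral f t m s = of_nat (Suc m) * simplex_integral f t (Suc m) s"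
proof (induction m arbitrary: s)
  case (Suc m)
  let ?V = "simplex_integral f t"
  let ?i = "\<lambda>s u. indicator {s..t} u :: ennreal"
  have [measurable]: "Measurable.pred (lborel \<Otimes>\<^sub>M lborel) (\<lambda>(s, u). u \<in> {s..t})"
    unfolding atLeastAtMost_iff by measurable
  have m: "(\<lambda>u. ?i s u * (f u * ?V (Suc m) u)) \<in> borel_measurable lborel"
    by measurable
  have swap: "(\<integral>\<^sup>+v. (\<integral>\<^sup>+u. ?i s u * ?i u v * (f v * (f u * ?V m u)) \<partial>lborel) \<partial>lborel)
      = (\<integral>\<^sup>+u. (\<integral>\<^sup>+v. ?i s u * ?i u v * (f v * (f u * ?V m u)) \<partial>lborel) \<partial>lborel)"
    by (rule lborel_pair.Fubini') measurable
  have "?V 1 s * ?V (Suc m) s = (\<integral>\<^sup>+v. ?i s v * f v * ?V (Suc m) s \<partial>lborel)"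
    by (simp add: nn_integral_multc del: simplex_integral.simps(2)[of f t m])
  also have "\<dots> = (\<integral>\<^sup>+v. (\<integral>\<^sup>+u. ?i s v * f v * (?i s u * (f u * ?V m u)) \<partial>lborel) \<partial>lborel)"
    by (simp add: nn_integral_cmult)
  \<comment> \<open>split the square according to \<open>v \<le> u\<close> or \<open>u \<le> v\<close>; the diagonal is null\<close>
  also have "\<dots> = (\<integral>\<^sup>+v. (\<integral>\<^sup>+u. ?i s v * f v * (?i v u * (f u * ?V m u)) +
      ?i s u * ?i u v * (f v * (f u * ?V m u)) \<partial>lborel) \<partial>lborel)"
  proof (rule nn_integral_cong, rule nn_integral_cong_AE)
    fix v
    show "AE u in lborel. ?i s v * f v * (?i s u * (f u * ?V m u)) =
        ?i s v * f v * (?i v u * (f u * ?V m u)) + ?i s u * ?i u v * (f v * (f u * ?V m u))"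
      using AE_lborel_singleton[of v]
      by eventually_elim (auto simp: indicator_def mult_ac)
  qed
  also have "\<dots> = (\<integral>\<^sup>+v. ?i s v * (f v * ?V (Suc m) v) \<partial>lborel) +
      (\<integral>\<^sup>+v. (\<integral>\<^sup>+u. ?i s u * ?i u v * (f v * (f u * ?V m u)) \<partial>lborel) \<partial>lborel)"
    by (simp add: nn_integral_add nn_integral_cmult mult.assoc)
  also have "(\<integral>\<^sup>+v. (\<integral>\<^sup>+u. ?i s u * ?i u v * (f v * (f u * ?V m u)) \<partial>lborel) \<partial>lborel)
      = (\<integral>\<^sup>+u. ?i s u * (f u * (?V 1 u * ?V m u)) \<partial>lborel)"
    unfolding swap
    by (intro nn_integral_cong) (simp add: nn_integral_cmult[symmetric] nn_integral_multc[symmetric] mult_ac)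
  also have "\<dots> = (\<integral>\<^sup>+u. of_nat (Suc m) * (?i s u * (f u * ?V (Suc m) u)) \<partial>lborel)"
    unfolding Suc.IH by (simp add: mult_ac del: simplex_integral.simps)
  also have "(\<integral>\<^sup>+u. of_nat (Suc m) * (?i s u * (f u * ?V (Suc m) u)) \<partial>lborel) =
      of_nat (Suc m) * ?V (Suc (Suc m)) s"
    using nn_integral_cmult[OF m, of "of_nat (Suc m)"] by simp
  also have "(\<integral>\<^sup>+v. ?i s v * (f v * ?V (Suc m) v) \<partial>lborel) = ?V (Suc (Suc m)) s" by simp
  finally show ?case by (simp add: algebra_simps del: simplex_integral.simps)
qed simp

lemma simplex_integral_power:
  assumes "f \<in> borel_measurable borel"
  shows "simplex_integral f t 1 s ^ m = fact m * simplex_integral f t m s"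
proof (induction m)
  case (Suc m)
  have "simplex_integral f t 1 s ^ Suc m = fact m * (simplex_integral f t 1 s * simplex_integral f t m s)"
    by (simp add: Suc.IH mult_ac del: simplex_integral.simps One_nat_def)
  also have "\<dots> = fact (Suc m) * simplex_integral f t (Suc m) s"
    unfolding simplex_integral_mult[OF assms] by (simp add: mult_ac del: simplex_integral.simps)
  finally show ?case .
qed simp

section \<open>Divided differences of the exponential\<close>

text \<open>Up to sign this is the divided difference of the constant 1. Removing nodes gives the
  recursion \<open>D (A - {a}) - D (A - {b}) = (x a - x b) * D A\<close>, and induction on the
  number of nodes applies.\<close>

lemma sum_inverse_prod_differences:
  fixes x :: "'i \<Rightarrow> 'f::field"
  assumes "finite A" "inj_on x A" "2 \<le> card A"
  shows "(\<Sum>k\<in>A. 1 / (\<Prod>i\<in>A - {k}. x i - x k)) = 0"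
  using assms
proof (induction "card A" arbitrary: A rule: less_induct)
  case less
  define D where "D B = (\<Sum>k\<in>B. 1 / (\<Prod>i\<in>B - {k}. x i - x k))" for B
  obtain a b where ab: "a \<in> A" "b \<in> A" "a \<noteq> b"
    using less.prems(3) by (metis card_le_Suc0_iff_eq less.prems(1) not_less_eq_eq numeral_2_eq_2)
  have ne: "x i - x k \<noteq> 0" if "i \<in> A" "k \<in> A" "i \<noteq> k" for i k
    using that less.prems(2) by (auto dest: inj_onD)
  \<comment> \<open>The factor \<open>x c - x k\<close> cancels in the product over \<open>A\<close>
    and makes the extra summand \<open>k = c\<close> vanish.\<close>
  have remove: "D (A - {c}) = (\<Sum>k\<in>A. (x c - x k) / (\<Prod>i\<in>A - {k}. x i - x k))" if c: "c \<in> A" for c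
  proof -
    have "D (A - {c}) = (\<Sum>k\<in>A - {c}. (x c - x k) / (\<Prod>i\<in>A - {k}. x i - x k))"
      unfolding D_def
    proof (rule sum.cong[OF refl])
      fix k assume k: "k \<in> A - {c}"
      then have neq: "x c \<noteq> x k" using less.prems(2) c by (auto dest: inj_onD)
      have "(\<Prod>i\<in>A - {k}. x i - x k) = (x c - x k) * (\<Prod>i\<in>A - {k} - {c}. x i - x k)"
        using k c less.prems(1) by (intro prod.remove) auto
      moreover have "A - {k} - {c} = A - {c} - {k}" by auto
      ultimately show "1 / (\<Prod>i\<in>A - {c} - {k}. x i - x k) = (x c - x k) / (\<Prod>i\<in>A - {k}. x i - x k)"
        using neq by simp
    qed
    also have "\<dots> = (\<Sum>k\<in>A. (x c - x k) / (\<Prod>i\<in>A - {k}. x i - x k))"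
      using c less.prems(1) by (simp add: sum.remove)
    finally show ?thesis .
  qed
  have "D (A - {a}) - D (A - {b}) = (x a - x b) * D A"
    unfolding remove[OF ab(1)] remove[OF ab(2)] D_def[of A] sum_distrib_left sum_subtractf[symmetric]
    by (simp add: diff_divide_distrib[symmetric])
  moreover have "D (A - {a}) = D (A - {b})"
  proof (cases "card A = 2")
    case True
    then have "A = {a, b}" using ab less.prems(1) by (intro card_seteq[symmetric]) auto
    then show ?thesis using ab by (simp add: D_def insert_Diff_if)
  next
    case False
    then have "D (A - {c}) = 0" if "c \<in> A" for c
      unfolding D_def using that less.prems
      by (intro less.hyps) (auto simp: card_Diff_singleton intro: inj_on_subset)
    then show ?thesis using ab by simp
  qed
  ultimately show ?case using ne[OF ab] by (simp add: D_def)
qed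

text \<open>For distinct nodes this is the divided difference of
  \<open>\<lambda>y. exp (r * y)\<close> at \<open>- \<Phi> 0, ..., - \<Phi> m\<close>.\<close>

definition exp_divided_difference :: "(nat \<Rightarrow> real) \<Rightarrow> nat \<Rightarrow> real \<Rightarrow> real" where
  "exp_divided_difference \<Phi> m r = (\<Sum>k\<le>m. exp (- \<Phi> k * r) / (\<Prod>i\<in>{..m}-{k}. \<Phi> i - \<Phi> k))"

lemma exp_divided_difference_0: "exp_divided_difference \<Phi> 0 r = exp (- \<Phi> 0 * r)"
  by (simp add: exp_divided_difference_def)

lemma exp_divided_difference_at_0:
  assumes "inj_on \<Phi> {..Suc m}"
  shows "exp_divided_difference \<Phi> (Suc m) 0 = 0"
  using sum_inverse_prod_differences[OF _ assms] by (simp add: exp_divided_difference_def)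

text \<open>Multiplying summand \<open>k\<close> of order \<open>m + 1\<close> by
  \<open>\<Phi> (Suc m) - \<Phi> k\<close> cancels the factor that the new node brought into the
  denominator and kills the summand of the new node itself. What remains has order
  \<open>m\<close>.\<close>

lemma exp_divided_difference_has_derivative:
  assumes inj: "inj_on \<Phi> {..Suc m}"
  shows "(exp_divided_difference \<Phi> (Suc m) has_real_derivative
    exp_divided_difference \<Phi> m r - \<Phi> (Suc m) * exp_divided_difference \<Phi> (Suc m) r) (at r within S)"
proof -
  let ?P = "\<lambda>m k. \<Prod>i\<in>{..m}-{k}. \<Phi> i - \<Phi> k"
  have "exp_divided_difference \<Phi> m r = (\<Sum>k\<le>m. (\<Phi> (Suc m) - \<Phi> k) * exp (- \<Phi> k * r) / ?P (Suc m) k)"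
    unfolding exp_divided_difference_def
  proof (rule sum.cong[OF refl])
    fix k assume k: "k \<in> {..m}"
    have "\<Phi> (Suc m) \<noteq> \<Phi> k" using inj k by (auto dest: inj_onD)
    moreover have "{..Suc m} - {k} = insert (Suc m) ({..m} - {k})" using k by auto
    ultimately show "exp (- \<Phi> k * r) / ?P m k = (\<Phi> (Suc m) - \<Phi> k) * exp (- \<Phi> k * r) / ?P (Suc m) k"
      by simp
  qed
  also have "\<dots> = (\<Sum>k\<le>Suc m. (\<Phi> (Suc m) - \<Phi> k) * exp (- \<Phi> k * r) / ?P (Suc m) k)"
    by simp
  also have "\<dots> = (\<Sum>k\<le>Suc m. - \<Phi> k * exp (- \<Phi> k * r) / ?P (Suc m) k) + \<Phi> (Suc m) * exp_divided_difference \<Phi> (Suc m) r"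
    unfolding exp_divided_difference_def sum_distrib_left sum.distrib[symmetric]
    by (rule sum.cong[OF refl]) (simp add: left_diff_distrib diff_divide_distrib)
  finally have *: "exp_divided_difference \<Phi> m r - \<Phi> (Suc m) * exp_divided_difference \<Phi> (Suc m) r =
      (\<Sum>k\<le>Suc m. - \<Phi> k * exp (- \<Phi> k * r) / ?P (Suc m) k)" by simp
  have "(exp_divided_difference \<Phi> (Suc m) has_real_derivative
      (\<Sum>k\<le>Suc m. - \<Phi> k * exp (- \<Phi> k * r) / ?P (Suc m) k)) (at r within S)"
    unfolding exp_divided_difference_def[abs_def]
    by (intro DERIV_sum DERIV_cdivide) (auto intro!: derivative_eq_intros)
  then show ?thesis unfolding * .
qed

text \<open>By the previous lemma \<open>exp (\<Phi> (m + 1) r)\<close> times the divided difference of order \<open>m + 1\<close>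
  vanishes at \<open>0\<close> and has as derivative a positive multiple of the one of order \<open>m\<close>.\<close>

lemma exp_divided_difference_nonneg:
  assumes "inj_on \<Phi> {..m}" "0 \<le> r"
  shows "0 \<le> exp_divided_difference \<Phi> m r"
  using assms
proof (induction m arbitrary: r)
  case (Suc m)
  let ?g = "\<lambda>r. exp (\<Phi> (Suc m) * r) * exp_divided_difference \<Phi> (Suc m) r"
  have "inj_on \<Phi> {..m}" using Suc.prems(1) by (rule inj_on_subset) auto
  then have IH: "0 \<le> exp_divided_difference \<Phi> m r" if "0 \<le> r" for r using Suc.IH that by blast
  have "?g 0 \<le> ?g r"
  proof (rule DERIV_nonneg_imp_nondecreasing[OF Suc.prems(2)])
    fix u assume u: "0 \<le> u" "u \<le> r"
    have "(?g has_real_derivative exp (\<Phi> (Suc m) * u) * exp_divided_difference \<Phi> m u) (at u)"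
      by (rule derivative_eq_intros exp_divided_difference_has_derivative[OF Suc.prems(1)] refl)+
         (simp add: algebra_simps)
    then show "\<exists>y. (?g has_real_derivative y) (at u) \<and> 0 \<le> y" using IH[OF u(1)] by force
  qed
  then show ?case
    by (simp add: exp_divided_difference_at_0[OF Suc.prems(1)] zero_le_mult_iff not_le[symmetric])
qed (simp add: exp_divided_difference_0)

text \<open>Subtracting \<open>exp (- \<Phi> n * r)\<close> times the value at 0, which is 0,
  removes the summand \<open>k = n\<close>.\<close>

lemma exp_divided_difference_explicit:
  assumes "inj_on \<Phi> {..n}" "1 \<le> n"
  shows "exp_divided_difference \<Phi> n r =
    (\<Sum>k=0..n-1. (exp (- \<Phi> k * r) - exp (- \<Phi> n * r)) / (\<Prod>i\<in>{0..n}-{k}. \<Phi> i - \<Phi> k))"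
proof -
  obtain m where n: "n = Suc m" using assms(2) by (cases n) auto
  have "exp_divided_difference \<Phi> n r = exp_divided_difference \<Phi> n r - exp (- \<Phi> n * r) * exp_divided_difference \<Phi> n 0"
    using assms(1) by (simp add: n exp_divided_difference_at_0)
  also have "\<dots> = (\<Sum>k\<le>n. (exp (- \<Phi> k * r) - exp (- \<Phi> n * r)) / (\<Prod>i\<in>{..n}-{k}. \<Phi> i - \<Phi> k))"
    by (simp add: exp_divided_difference_def sum_distrib_left sum_subtractf[symmetric] diff_divide_distrib)
  finally show ?thesis by (simp add: n atLeast0AtMost)
qed

section \<open>Iterated convolution of exponentials\<close>

text \<open>The counterpart of \<open>simplex_integral\<close> after taking expectations: with
  \<open>m + 1\<close> variables left, the increment of \<open>X\<close> from \<open>s\<close> to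
  \<open>u\<close> enters all of them, which produces its exponential moment of order
  \<open>m + 1\<close>.\<close>

fun moment_integral :: "(nat \<Rightarrow> real) \<Rightarrow> real \<Rightarrow> nat \<Rightarrow> real \<Rightarrow> ennreal" where
  "moment_integral \<Phi> t 0 s = 1"
| "moment_integral \<Phi> t (Suc m) s = (\<integral>\<^sup>+u. indicator {s..t} u *
    (ennreal (exp (- (u - s) * \<Phi> (Suc m))) * moment_integral \<Phi> t m u) \<partial>lborel)"

lemma measurable_moment_integral [measurable]: "moment_integral \<Phi> t m \<in> borel_measurable borel"
proof (induction m)
  case (Suc m)
  note [measurable] = Suc.IH
  have [measurable]: "Measurable.pred (borel \<Otimes>\<^sub>M lborel) (\<lambda>(s, u). u \<in> {s..t})"
    unfolding atLeastAtMost_iff by measurable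
  show ?case
    unfolding moment_integral.simps[abs_def]
    by (rule lborel.borel_measurable_nn_integral) measurable
qed simp

text \<open>By the differential equation of the divided differences, the integrand has the
  antiderivative \<open>F\<close> given below. It vanishes at \<open>u = t\<close>, and its value at
  \<open>u = s\<close> gives the result. \<open>\<Phi> 0 = 0\<close> starts the induction.\<close>

lemma moment_integral_eq:
  assumes "inj_on \<Phi> {..m}" "\<Phi> 0 = 0" "s \<le> t"
  shows "moment_integral \<Phi> t m s = ennreal (exp_divided_difference \<Phi> m (t - s))"
  using assms
proof (induction m arbitrary: s)
  case (Suc m)
  let ?E = "exp_divided_difference \<Phi>"
  let ?e = "\<lambda>u. exp (- (u - s) * \<Phi> (Suc m))"
  have inj: "inj_on \<Phi> {..m}" using Suc.prems(1) by (rule inj_on_subset) auto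
  have "moment_integral \<Phi> t (Suc m) s = (\<integral>\<^sup>+u. ennreal (?e u * ?E m (t - u)) * indicator {s..t} u \<partial>lborel)"
    unfolding moment_integral.simps
    by (intro nn_integral_cong)
       (auto simp: indicator_def Suc.IH[OF inj Suc.prems(2)] ennreal_mult' exp_divided_difference_nonneg[OF inj])
  also have "\<dots> = ennreal (- (?e t * ?E (Suc m) (t - t)) - - (?e s * ?E (Suc m) (t - s)))"
  proof (rule nn_integral_FTC_Icc[where F="\<lambda>u. - (?e u * ?E (Suc m) (t - u))"])
    show "(\<lambda>u. ?e u * ?E m (t - u)) \<in> borel_measurable borel"
      unfolding exp_divided_difference_def[abs_def] by measurable
    fix u assume "u \<in> {s..t}"
    then have u: "s \<le> u" "u \<le> t" by auto
    have "((\<lambda>u. ?E (Suc m) (t - u)) has_real_derivative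
        (?E m (t - u) - \<Phi> (Suc m) * ?E (Suc m) (t - u)) * (- 1)) (at u)"
      by (rule DERIV_chain2[OF exp_divided_difference_has_derivative[OF Suc.prems(1)]])
         (auto intro!: derivative_eq_intros)
    note [derivative_intros] = this
    show "((\<lambda>u. - (?e u * ?E (Suc m) (t - u))) has_real_derivative ?e u * ?E m (t - u)) (at u)"
      by (rule derivative_eq_intros refl)+ (simp add: algebra_simps)
    show "0 \<le> ?e u * ?E m (t - u)" using u exp_divided_difference_nonneg[OF inj] by simp
  qed (use Suc.prems in auto)
  finally show ?case by (simp add: exp_divided_difference_at_0[OF Suc.prems(1)])
qed (simp add: exp_divided_difference_0)

section \<open>Moments of the exponential functional\<close>

text \<open>Summation by parts: the increment with index \<open>i\<close> is contained in the
  \<open>j - i\<close> values \<open>x (Suc i), ..., x j\<close>.\<close>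

lemma sum_by_increments:
  fixes x :: "nat \<Rightarrow> real"
  assumes "x 0 = 0"
  shows "(\<Sum>i<j. x (Suc i)) = (\<Sum>i<j. real (j - i) * (x (Suc i) - x i))"
proof (induction j)
  case (Suc j)
  have "(\<Sum>i<Suc j. real (Suc j - i) * (x (Suc i) - x i)) =
      (\<Sum>i<Suc j. real (j - i) * (x (Suc i) - x i) + (x (Suc i) - x i))"
    by (rule sum.cong[OF refl]) (auto simp: Suc_diff_le algebra_simps)
  also have "\<dots> = (\<Sum>i<j. x (Suc i)) + x (Suc j)"
    unfolding sum.distrib Suc.IH by (simp add: sum_lessThan_telescope assms del: sum.lessThan_Suc) simp
  finally show ?case by simp
qed simp

section \<open>Joint measurability of the paths\<close>

context levy_process
begin

text \<open>By right continuity \<open>X\<close> is the limit of its values at grid points of mesh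
  \<open>1 / (N + 1)\<close>, and for fixed \<open>N\<close> the index of the grid point takes
  countably many values.\<close>

lemma measurable_joint [measurable]:
  "(\<lambda>p. X (max 0 (snd p)) (fst p)) \<in> borel_measurable (M \<Otimes>\<^sub>M borel)"
proof (rule borel_measurable_LIMSEQ_real)
  \<comment> \<open>The summand 1 puts the grid point strictly to the right of the time, as
    \<open>at_right\<close> demands.\<close>
  define r where "r N s = (real (nat \<lfloor>max 0 s * real (Suc N)\<rfloor>) + 1) / real (Suc N)" for N s
  fix p :: "'a \<times> real" assume p: "p \<in> space (M \<Otimes>\<^sub>M borel)"
  let ?s = "max 0 (snd p)"
  have r: "?s < r N (snd p)" "r N (snd p) \<le> ?s + inverse (real (Suc N))" for N
  proof -
    have "0 \<le> ?s * real (Suc N)" by simp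
    then have e: "real (nat \<lfloor>?s * real (Suc N)\<rfloor>) = of_int \<lfloor>?s * real (Suc N)\<rfloor>" by simp
    have "?s * real (Suc N) < real (nat \<lfloor>?s * real (Suc N)\<rfloor>) + 1" unfolding e by linarith
    then show "?s < r N (snd p)" by (simp only: r_def pos_less_divide_eq of_nat_0_less_iff zero_less_Suc)
    have "real (nat \<lfloor>?s * real (Suc N)\<rfloor>) + 1 \<le> ?s * real (Suc N) + 1" unfolding e by simp
    then show "r N (snd p) \<le> ?s + inverse (real (Suc N))"
      by (simp add: r_def field_simps del: of_nat_Suc)
  qed
  have "(\<lambda>N. r N (snd p)) \<longlonglongrightarrow> ?s"
  proof (rule tendsto_sandwich[OF _ _ tendsto_const])
    show "(\<lambda>N. ?s + inverse (real (Suc N))) \<longlonglongrightarrow> ?s"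
      using tendsto_add[OF tendsto_const LIMSEQ_inverse_real_of_nat] by simp
  qed (use r in \<open>auto intro!: always_eventually less_imp_le\<close>)
  then have "filterlim (\<lambda>N. r N (snd p)) (at_right ?s) sequentially"
    using r(1) by (auto simp: filterlim_at intro!: always_eventually less_imp_neq[symmetric])
  moreover have "((\<lambda>s. X s (fst p)) \<longlongrightarrow> X ?s (fst p)) (at_right ?s)"
    using right_continuous[of "fst p" ?s] p by (auto simp: continuous_within space_pair_measure)
  ultimately show "(\<lambda>N. X (r N (snd p)) (fst p)) \<longlonglongrightarrow> X ?s (fst p)"
    by (rule filterlim_compose[rotated])
next
  fix N
  show "(\<lambda>p. X ((real (nat \<lfloor>max 0 (snd p) * real (Suc N)\<rfloor>) + 1) / real (Suc N)) (fst p))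
      \<in> borel_measurable (M \<Otimes>\<^sub>M borel)"
  proof (rule measurable_compose_countable[where f="\<lambda>k p. X ((real k + 1) / real (Suc N)) (fst p)"])
    show "(\<lambda>p. X ((real k + 1) / real (Suc N)) (fst p)) \<in> borel_measurable (M \<Otimes>\<^sub>M borel)" for k
      using measurable_X[of "(real k + 1) / real (Suc N)"] by (auto intro: measurable_compose[OF measurable_fst])
  qed measurable
qed

text \<open>The \<open>max\<close> is there because \<open>X\<close> need not be measurable at negative times.\<close>

definition exp_path :: "'a \<Rightarrow> real \<Rightarrow> ennreal" where
  "exp_path \<omega> s = ennreal (exp (- X (max 0 s) \<omega>))"

lemma measurable_exp_path_joint [measurable]:
  "(\<lambda>p. exp_path (fst p) (snd p)) \<in> borel_measurable (M \<Otimes>\<^sub>M borel)"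
  unfolding exp_path_def by measurable

lemma measurable_exp_path:
  assumes "\<omega> \<in> space M"
  shows "exp_path \<omega> \<in> borel_measurable borel"
  using measurable_compose[OF measurable_Pair1'[OF assms] measurable_exp_path_joint] by simp

lemma measurable_simplex_integral_joint [measurable]:
  "(\<lambda>p. simplex_integral (exp_path (fst p)) t m (snd p)) \<in> borel_measurable (M \<Otimes>\<^sub>M borel)"
proof (induction m)
  case (Suc m)
  have c: "(\<lambda>q. (fst (fst q), snd q)) \<in> (M \<Otimes>\<^sub>M borel) \<Otimes>\<^sub>M lborel \<rightarrow>\<^sub>M M \<Otimes>\<^sub>M borel"
    by measurable
  have [measurable]: "(\<lambda>q. simplex_integral (exp_path (fst (fst q))) t m (snd q))
      \<in> borel_measurable ((M \<Otimes>\<^sub>M borel) \<Otimes>\<^sub>M lborel)"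
    "(\<lambda>q. exp_path (fst (fst q)) (snd q)) \<in> borel_measurable ((M \<Otimes>\<^sub>M borel) \<Otimes>\<^sub>M lborel)"
    using measurable_compose[OF c Suc.IH] measurable_compose[OF c measurable_exp_path_joint] by simp_all
  have [measurable]: "Measurable.pred ((M \<Otimes>\<^sub>M borel) \<Otimes>\<^sub>M lborel) (\<lambda>q. snd q \<in> {snd (fst q)..t})"
    unfolding atLeastAtMost_iff by measurable
  show ?case
    unfolding simplex_integral.simps
    by (rule lborel.borel_measurable_nn_integral) (simp add: split_beta')
qed simp

section \<open>Expectations of the simplex integrals\<close>

text \<open>Independence turns the expectation into a product, and stationarity replaces each
  increment by \<open>X\<close> at the length of its interval.\<close>

lemma increments_moment:
  assumes mom: "\<And>k s. k \<le> n \<Longrightarrow> 0 \<le> s \<Longrightarrow>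
      (\<integral>\<^sup>+\<omega>. ennreal (exp (- real k * X s \<omega>)) \<partial>M) = ennreal (exp (- s * \<Phi> k))"
    and \<tau>: "0 \<le> \<tau> 0" "mono \<tau>" and w: "\<And>i. i < j \<Longrightarrow> w i \<le> (n::nat)"
  shows "(\<integral>\<^sup>+\<omega>. (\<Prod>i<j. ennreal (exp (- real (w i) * (X (\<tau> (Suc i)) \<omega> - X (\<tau> i) \<omega>)))) \<partial>M) =
    (\<Prod>i<j. ennreal (exp (- (\<tau> (Suc i) - \<tau> i) * \<Phi> (w i))))"
proof -
  let ?g = "\<lambda>i x. ennreal (exp (- real (w i) * x))"
  have "indep_vars (\<lambda>_. borel) (\<lambda>i \<omega>. ?g i (X (\<tau> (Suc i)) \<omega> - X (\<tau> i) \<omega>)) {..<j}"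
    by (rule indep_vars_compose2[OF indep_increments[OF \<tau>, of j]]) simp
  then have "(\<integral>\<^sup>+\<omega>. (\<Prod>i<j. ?g i (X (\<tau> (Suc i)) \<omega> - X (\<tau> i) \<omega>)) \<partial>M) =
      (\<Prod>i<j. \<integral>\<^sup>+\<omega>. ?g i (X (\<tau> (Suc i)) \<omega> - X (\<tau> i) \<omega>) \<partial>M)"
    by (intro indep_vars_nn_integral) auto
  also have "\<dots> = (\<Prod>i<j. ennreal (exp (- (\<tau> (Suc i) - \<tau> i) * \<Phi> (w i))))"
  proof (rule prod.cong[OF refl])
    fix i assume "i \<in> {..<j}"
    have \<tau>i: "0 \<le> \<tau> i" "\<tau> i \<le> \<tau> (Suc i)"
      using \<tau>(1) monoD[OF \<tau>(2), of 0 i] monoD[OF \<tau>(2), of i "Suc i"] by auto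
    have [measurable]: "X (\<tau> i) \<in> borel_measurable M" "X (\<tau> (Suc i)) \<in> borel_measurable M"
        "X (\<tau> (Suc i) - \<tau> i) \<in> borel_measurable M"
      using \<tau>i by (auto intro: measurable_X)
    have "(\<integral>\<^sup>+\<omega>. ?g i (X (\<tau> (Suc i)) \<omega> - X (\<tau> i) \<omega>) \<partial>M) =
        (\<integral>\<^sup>+x. ?g i x \<partial>distr M borel (\<lambda>\<omega>. X (\<tau> (Suc i)) \<omega> - X (\<tau> i) \<omega>))"
      by (subst nn_integral_distr) auto
    also have "\<dots> = (\<integral>\<^sup>+\<omega>. ?g i (X (\<tau> (Suc i) - \<tau> i) \<omega>) \<partial>M)"
      unfolding stationary_increments[OF \<tau>i] by (subst nn_integral_distr) auto
    also have "\<dots> = ennreal (exp (- (\<tau> (Suc i) - \<tau> i) * \<Phi> (w i)))"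
      using \<tau>i w \<open>i \<in> {..<j}\<close> by (intro mom) auto
    finally show "(\<integral>\<^sup>+\<omega>. ?g i (X (\<tau> (Suc i)) \<omega> - X (\<tau> i) \<omega>) \<partial>M) = \<dots>" .
  qed
  finally show ?thesis .
qed

text \<open>The times \<open>\<tau> 1 \<le> \<dots> \<le> \<tau> j\<close> are the integration variables already fixed, so that only
  finite-dimensional laws of \<open>X\<close> enter. The increment over \<open>[\<tau> i, \<tau> (i + 1)]\<close> occurs in each of
  the \<open>j - i\<close> factors with a later time and in all \<open>m\<close> remaining ones.\<close>

lemma simplex_integral_moment:
  assumes mom: "\<And>k s. k \<le> n \<Longrightarrow> 0 \<le> s \<Longrightarrow>
      (\<integral>\<^sup>+\<omega>. ennreal (exp (- real k * X s \<omega>)) \<partial>M) = ennreal (exp (- s * \<Phi> k))"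
    and "\<tau> 0 = 0" "mono \<tau>" "j + m \<le> n"
  shows "(\<integral>\<^sup>+\<omega>. (\<Prod>i<j. exp_path \<omega> (\<tau> (Suc i))) * simplex_integral (exp_path \<omega>) t m (\<tau> j) \<partial>M) =
    (\<Prod>i<j. ennreal (exp (- (\<tau> (Suc i) - \<tau> i) * \<Phi> (j + m - i)))) * moment_integral \<Phi> t m (\<tau> j)"
  using assms(2-)
proof (induction m arbitrary: j \<tau>)
  case 0
  have \<tau>: "0 \<le> \<tau> i" for i using 0 monoD[OF 0(2), of 0 i] by simp
  have "(\<integral>\<^sup>+\<omega>. (\<Prod>i<j. exp_path \<omega> (\<tau> (Suc i))) \<partial>M) =
      (\<integral>\<^sup>+\<omega>. (\<Prod>i<j. ennreal (exp (- real (j - i) * (X (\<tau> (Suc i)) \<omega> - X (\<tau> i) \<omega>)))) \<partial>M)"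
  proof (rule nn_integral_cong_AE)
    \<comment> \<open>The summation by parts starts from \<open>X 0 = 0\<close>, which holds almost
      surely.\<close>
    show "AE \<omega> in M. (\<Prod>i<j. exp_path \<omega> (\<tau> (Suc i))) =
        (\<Prod>i<j. ennreal (exp (- real (j - i) * (X (\<tau> (Suc i)) \<omega> - X (\<tau> i) \<omega>))))"
      using starts_at_0
    proof eventually_elim
      case (elim \<omega>)
      have "(\<Prod>i<j. exp_path \<omega> (\<tau> (Suc i))) = ennreal (exp (- (\<Sum>i<j. X (\<tau> (Suc i)) \<omega>)))"
        using \<tau> by (simp add: exp_path_def prod_ennreal exp_sum sum_negf[symmetric])
      also have "\<dots> = ennreal (exp (\<Sum>i<j. - real (j - i) * (X (\<tau> (Suc i)) \<omega> - X (\<tau> i) \<omega>)))"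
        using sum_by_increments[of "\<lambda>i. X (\<tau> i) \<omega>" j] elim 0(1) by (simp add: sum_negf del: of_nat_diff)
      also have "\<dots> = (\<Prod>i<j. ennreal (exp (- real (j - i) * (X (\<tau> (Suc i)) \<omega> - X (\<tau> i) \<omega>))))"
        by (simp add: prod_ennreal exp_sum)
      finally show ?case .
    qed
  qed
  also have "\<dots> = (\<Prod>i<j. ennreal (exp (- (\<tau> (Suc i) - \<tau> i) * \<Phi> (j - i))))"
    using 0 by (intro increments_moment[OF mom]) auto
  finally show ?case by simp
next
  case (Suc m)
  interpret P: pair_sigma_finite M lborel ..
  let ?V = "\<lambda>\<omega>. simplex_integral (exp_path \<omega>) t m"
  let ?Q = "\<lambda>\<omega>. \<Prod>i<j. exp_path \<omega> (\<tau> (Suc i))"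
  let ?R = "\<Prod>i<j. ennreal (exp (- (\<tau> (Suc i) - \<tau> i) * \<Phi> (j + Suc m - i)))"
  let ?i = "indicator {\<tau> j..t} :: real \<Rightarrow> ennreal"
  have \<tau>: "0 \<le> \<tau> i" for i using Suc.prems(1) monoD[OF Suc.prems(2), of 0 i] by simp
  have [measurable]: "(\<lambda>\<omega>. exp_path \<omega> s) \<in> borel_measurable M" if "0 \<le> s" for s
    using measurable_X[OF that] that unfolding exp_path_def by simp
  have Q [measurable]: "?Q \<in> borel_measurable M" using \<tau> by measurable
  have FV [measurable]: "(\<lambda>p. exp_path (fst p) (snd p)) \<in> borel_measurable (M \<Otimes>\<^sub>M lborel)"
      "(\<lambda>p. ?V (fst p) (snd p)) \<in> borel_measurable (M \<Otimes>\<^sub>M lborel)"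
    using measurable_exp_path_joint measurable_simplex_integral_joint[of t m]
    by (simp_all cong: measurable_cong_sets sets_pair_measure_cong)
  have "(\<integral>\<^sup>+\<omega>. ?Q \<omega> * simplex_integral (exp_path \<omega>) t (Suc m) (\<tau> j) \<partial>M) =
      (\<integral>\<^sup>+\<omega>. (\<integral>\<^sup>+u. ?Q \<omega> * (?i u * (exp_path \<omega> u * ?V \<omega> u)) \<partial>lborel) \<partial>M)"
  proof (rule nn_integral_cong)
    fix \<omega> assume "\<omega> \<in> space M"
    note [measurable] = measurable_exp_path[OF this]
    show "?Q \<omega> * simplex_integral (exp_path \<omega>) t (Suc m) (\<tau> j) =
        (\<integral>\<^sup>+u. ?Q \<omega> * (?i u * (exp_path \<omega> u * ?V \<omega> u)) \<partial>lborel)"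
      by (simp add: nn_integral_cmult)
  qed
  also have "\<dots> = (\<integral>\<^sup>+u. (\<integral>\<^sup>+\<omega>. ?Q \<omega> * (?i u * (exp_path \<omega> u * ?V \<omega> u)) \<partial>M) \<partial>lborel)"
    by (rule P.Fubini'[symmetric]) (simp add: split_beta')
  also have "\<dots> = (\<integral>\<^sup>+u. ?R * (?i u * (ennreal (exp (- (u - \<tau> j) * \<Phi> (Suc m))) * moment_integral \<Phi> t m u)) \<partial>lborel)"
  proof (rule nn_integral_cong)
    fix u
    show "(\<integral>\<^sup>+\<omega>. ?Q \<omega> * (?i u * (exp_path \<omega> u * ?V \<omega> u)) \<partial>M) =
        ?R * (?i u * (ennreal (exp (- (u - \<tau> j) * \<Phi> (Suc m))) * moment_integral \<Phi> t m u))"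
    proof (cases "u \<in> {\<tau> j..t}")
      case True
      \<comment> \<open>The integration variable \<open>u\<close> becomes the time with index
        \<open>j + 1\<close>; later indices repeat it, which keeps \<open>\<sigma>\<close>
        monotone.\<close>
      define \<sigma> where "\<sigma> i = (if i \<le> j then \<tau> i else u)" for i
      have \<sigma>: "mono \<sigma>"
        using Suc.prems(2) True
        by (auto simp: \<sigma>_def mono_def) (metis order_trans)
      have "(\<integral>\<^sup>+\<omega>. (\<Prod>i<Suc j. exp_path \<omega> (\<sigma> (Suc i))) * ?V \<omega> (\<sigma> (Suc j)) \<partial>M) =
          (\<Prod>i<Suc j. ennreal (exp (- (\<sigma> (Suc i) - \<sigma> i) * \<Phi> (Suc j + m - i)))) * moment_integral \<Phi> t m (\<sigma> (Suc j))"
      proof (rule Suc.IH[OF _ \<sigma>])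
        show "\<sigma> 0 = 0" using Suc.prems(1) by (simp add: \<sigma>_def)
      qed (use Suc.prems(3) in simp)
      then show ?thesis using True by (simp add: \<sigma>_def mult.assoc)
    qed simp
  qed
  also have "\<dots> = ?R * moment_integral \<Phi> t (Suc m) (\<tau> j)"
  proof -
    have [measurable]: "moment_integral \<Phi> t m \<in> borel_measurable borel" by (rule measurable_moment_integral)
    show ?thesis by (simp add: nn_integral_cmult)
  qed
  finally show ?case .
qed

section \<open>From extended to real values\<close>

text \<open>The default values match: for a path with infinite integral, the Bochner integral and
  \<open>enn2real\<close> of infinity are both 0.\<close>

lemma enn2real_simplex_integral_exp_path:
  assumes "\<omega> \<in> space M"
  shows "exp_functional X t \<omega> = enn2real (simplex_integral (exp_path \<omega>) t 1 0)"
proof -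
  have [measurable]: "(\<lambda>s. X (max 0 s) \<omega>) \<in> borel_measurable borel"
    using measurable_compose[OF measurable_Pair1'[OF assms] measurable_joint] by simp
  have "exp_functional X t \<omega> = (\<integral>s. indicator {0..t} s * exp (- X (max 0 s) \<omega>) \<partial>lborel)"
    unfolding exp_functional_def set_lebesgue_integral_def
    by (rule Bochner_Integration.integral_cong) (auto simp: indicator_def)
  also have "\<dots> = enn2real (\<integral>\<^sup>+s. ennreal (indicator {0..t} s * exp (- X (max 0 s) \<omega>)) \<partial>lborel)"
    by (rule integral_eq_nn_integral) auto
  also have "(\<integral>\<^sup>+s. ennreal (indicator {0..t} s * exp (- X (max 0 s) \<omega>)) \<partial>lborel) =
      simplex_integral (exp_path \<omega>) t 1 0"
    unfolding One_nat_def simplex_integral.simps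
    by (rule nn_integral_cong) (simp add: exp_path_def indicator_def)
  finally show ?thesis .
qed

text \<open>The moment is first computed in extended values. Since it is finite, the extended path
  integral is finite almost surely and agrees there with \<open>exp_functional\<close>.\<close>

lemma exp_functional_moment:
  assumes mom: "\<And>k s. k \<le> n \<Longrightarrow> 0 \<le> s \<Longrightarrow>
      (\<integral>\<^sup>+\<omega>. ennreal (exp (- real k * X s \<omega>)) \<partial>M) = ennreal (exp (- s * \<Phi> k))"
    and n: "1 \<le> n" and t: "0 \<le> t" and \<Phi>: "inj_on \<Phi> {..n}" "\<Phi> 0 = 0"
  shows "has_bochner_integral M (\<lambda>\<omega>. exp_functional X t \<omega> ^ n) (fact n * exp_divided_difference \<Phi> n t)"
proof (rule has_bochner_integral_nn_integral)
  let ?J = "\<lambda>\<omega>. simplex_integral (exp_path \<omega>) t 1 0"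
  have V [measurable]: "(\<lambda>\<omega>. simplex_integral (exp_path \<omega>) t m 0) \<in> borel_measurable M" for m
    using measurable_compose[OF measurable_Pair2'[of 0 borel M] measurable_simplex_integral_joint[of t m]]
    by simp
  have E: "0 \<le> exp_divided_difference \<Phi> n t"
    by (rule exp_divided_difference_nonneg[OF \<Phi>(1) t])
  then show "0 \<le> fact n * exp_divided_difference \<Phi> n t" by simp
  have "(\<integral>\<^sup>+\<omega>. simplex_integral (exp_path \<omega>) t n 0 \<partial>M) = moment_integral \<Phi> t n 0"
    using simplex_integral_moment[OF mom, where j=0 and m=n and \<tau>="\<lambda>_. 0" and t=t] by (simp add: mono_def)
  also have "\<dots> = ennreal (exp_divided_difference \<Phi> n t)"
    using moment_integral_eq[OF \<Phi> t] by simp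
  finally have V_moment: "(\<integral>\<^sup>+\<omega>. simplex_integral (exp_path \<omega>) t n 0 \<partial>M) = \<dots>" .
  have "(\<integral>\<^sup>+\<omega>. ?J \<omega> ^ n \<partial>M) = (\<integral>\<^sup>+\<omega>. fact n * simplex_integral (exp_path \<omega>) t n 0 \<partial>M)"
    by (intro nn_integral_cong simplex_integral_power measurable_exp_path)
  also have "\<dots> = fact n * ennreal (exp_divided_difference \<Phi> n t)"
    unfolding V_moment[symmetric] by (rule nn_integral_cmult) (rule V)
  also have "(fact n :: ennreal) = ennreal (fact n)"
    by (metis ennreal_of_nat_eq_real_of_nat of_nat_fact)
  also have "\<dots> * ennreal (exp_divided_difference \<Phi> n t) = ennreal (fact n * exp_divided_difference \<Phi> n t)"
    using E by (simp add: ennreal_mult')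
  finally have J: "(\<integral>\<^sup>+\<omega>. ?J \<omega> ^ n \<partial>M) = \<dots>" .
  have "AE \<omega> in M. ?J \<omega> ^ n \<noteq> \<infinity>"
    by (rule nn_integral_PInf_AE) (use J V in auto)
  then have "AE \<omega> in M. ennreal (exp_functional X t \<omega> ^ n) = ?J \<omega> ^ n"
    using AE_space
  proof eventually_elim
    case (elim \<omega>)
    \<comment> \<open>\<open>n \<ge> 1\<close> enters here: a power with exponent 0 is finite even
      for an infinite base.\<close>
    then have "?J \<omega> \<noteq> \<infinity>" using n by (auto simp: power_eq_top_ennreal)
    then show ?case
      unfolding enn2real_simplex_integral_exp_path[OF elim(2)]
      by (simp add: ennreal_power[symmetric] ennreal_enn2real_if)
  qed
  then show "(\<integral>\<^sup>+\<omega>. ennreal (exp_functional X t \<omega> ^ n) \<partial>M) = ennreal (fact n * exp_divided_difference \<Phi> n t)"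
    unfolding J[symmetric] by (rule nn_integral_cong_AE)
  have "(\<lambda>\<omega>. enn2real (?J \<omega>) ^ n) \<in> borel_measurable M" using V[of 1] by measurable
  then show "(\<lambda>\<omega>. exp_functional X t \<omega> ^ n) \<in> borel_measurable M"
    by (simp add: enn2real_simplex_integral_exp_path cong: measurable_cong)
  show "AE \<omega> in M. 0 \<le> exp_functional X t \<omega> ^ n"
    using enn2real_simplex_integral_exp_path by (intro AE_I2) simp
qed

end

theorem corollary1:
  fixes M :: "'a measure" and X :: "real \<Rightarrow> 'a \<Rightarrow> real"
    and b\<^sub>0 c\<^sub>0 :: real and K\<^sub>0 :: "real measure" and n :: nat and t :: real
  defines "\<Phi> \<equiv> (\<lambda>k::nat. laplace_exponent b\<^sub>0 c\<^sub>0 K\<^sub>0 (real k))"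
  assumes "n \<ge> 1"
    and "levy_process M X"
    and "has_levy_parameters M X b\<^sub>0 c\<^sub>0 K\<^sub>0"
    and "(\<integral>\<^sup>+x. ennreal (min (x\<^sup>2) \<bar>x\<bar>) \<partial>K\<^sub>0) < \<infinity>"
    and "\<exists>\<delta>>0. (\<integral>\<^sup>+x\<in>{..<-1}. ennreal (exp (- (real n + \<delta>) * x)) \<partial>K\<^sub>0) < \<infinity>"
    and "inj_on \<Phi> {0..n}"
    and "t > 0"
  shows "integrable M (\<lambda>\<omega>. exp_functional X t \<omega> ^ n) \<and>
    (\<integral>\<omega>. exp_functional X t \<omega> ^ n \<partial>M) =
      fact n * (\<Sum>k=0..n-1. (exp (- \<Phi> k * t) - exp (- \<Phi> n * t)) /
        (\<Prod>i\<in>{0..n}-{k}. \<Phi> i - \<Phi> k))"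
proof -
  interpret levy_process M X by fact
  obtain \<delta> where \<delta>: "0 < \<delta>"
    "(\<integral>\<^sup>+x\<in>{..<-1}. ennreal (exp (- (real n + \<delta>) * x)) \<partial>K\<^sub>0) < \<infinity>"
    using assms(6) by blast
  \<comment> \<open>All orders \<open>k \<le> n\<close> lie strictly below
    \<open>n + \<delta>\<close>, the order of the exponential moment of the jumps.\<close>
  have mom: "(\<integral>\<^sup>+\<omega>. ennreal (exp (- real k * X s \<omega>)) \<partial>M) = ennreal (exp (- s * \<Phi> k))"
    if "k \<le> n" "0 \<le> s" for k s
    unfolding \<Phi>_def
    by (rule exponential_moment[OF assms(4,5) \<delta>(2)]) (use that \<delta>(1) in auto)
  have inj: "inj_on \<Phi> {..n}" using assms(7) by (simp add: atLeast0AtMost)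
  have "\<Phi> 0 = 0" by (simp add: \<Phi>_def laplace_exponent_def)
  with exp_functional_moment[OF mom assms(2) _ inj] assms(8)
  have "has_bochner_integral M (\<lambda>\<omega>. exp_functional X t \<omega> ^ n) (fact n * exp_divided_difference \<Phi> n t)"
    by simp
  then show ?thesis
    unfolding exp_divided_difference_explicit[OF inj assms(2)] has_bochner_integral_iff .
qed

end
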